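(* Let $\lambda\in P^+$. The map $\psi_\lambda:\Sigma_\iota[\lambda]\to\mathcal T'(\lambda)$, $\overrightarrow{x}\mapsto T_{\overrightarrow{x}}$, is a crystal isomorphism.
   Context: Fix $n$, $I=\{1,\dots,n\}$. Let $\epsilon_1,\dots,\epsilon_{n+1}$ be the standard basis of $\mathbb R^{n+1}$, $\alpha_i=\epsilon_i-\epsilon_{i+1}$, $\omega_i=\epsilon_1+\dots+\epsilon_i$, $P=\bigoplus_{i\in I}\mathbb Z\omega_i$ (integer combinations of the $\epsilon_j$ are regarded in $P$ modulo $\epsilon_1+\dots+\epsilon_{n+1}$), $P^+=\bigoplus\mathbb Z_{\ge0}\omega_i$, $\langle\alpha_i^\vee,\epsilon_j\rangle=\delta_{i,j}-\delta_{i+1,j}$. Write $\lambda=\sum_{i=1}^n a_i\omega_i$, $\lambda_i=\sum_{j=i}^n a_j$, $\lambda_{n+1}=0$; identify $\lambda$ with the Young diagram with rows $\lambda_1\ge\dots\ge\lambda_n$. A crystal of type $A_n$ is a set $B$ with maps $\mathrm{wt}:B\to P$, $\tilde e_i,\tilde f_i:B\to B\cup\{0\}$, $\varepsilon_i,\varphi_i:B\to\mathbb Z\cup\{-\infty\}$ ($i\in I$) such that: $\varphi_i(b)=\varepsilon_i(b)+\langle\alpha_i^\vee,\mathrm{wt}(b)\rangle$; if $\tilde e_ib\ne0$ then $\mathrm{wt}(\tilde e_ib)=\mathrm{wt}(b)+\alpha_i$, $\varepsilon_i(\tilde e_ib)=\varepsilon_i(b)-1$, $\varphi_i(\tilde e_ib)=\varphi_i(b)+1$;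 if $\tilde f_ib\neq0$ then $\mathrm{wt}(\tilde f_ib)=\mathrm{wt}(b)-\alpha_i$, $\varepsilon_i(\tilde f_ib)=\varepsilon_i(b)+1$, $\varphi_i(\tilde f_ib)=\varphi_i(b)-1$; $\tilde f_ib=b'$ iff $b=\tilde e_ib'$ for $b,b'\in B$; and $\tilde e_ib=\tilde f_ib=0$ if $\varphi_i(b)=-\infty$. A crystal isomorphism $B_1\to B_2$ is a bijection $B_1\cup\{0\}\to B_2\cup\{0\}$ with $0\mapsto 0$ preserving $\mathrm{wt},\varepsilon_i,\varphi_i$ and commuting with all $\tilde e_i,\tilde f_i$. Tableaux. $\mathcal T(\lambda)$ is the set of semistandard Young tableaux of shape $\lambda$ with entries in $\{1,\dots,n+1\}$ (rows weakly increasing, columns strictly increasing). Crystal structure on $\mathcal T(\lambda)$: read the boxes by the Far-Eastern reading (columns from right to left, each column from top to bottom); write $+$ for each entry $i$ and $-$ for each entry $i+1$; cancel successively all pairs $(+,-)$ ($+$ before $-$); the remaining sequence of $-$'s followed by $+$'s is the $i$-signature. $\tilde f_iT$ changes $i$ to $i+1$ in the box of the leftmost $+$ ($0$ if there is none); $\tilde e_iT$ changes $i+1$ to $i$ in the box of the rightmost $-$ ($0$ if there is none); $\varepsilon_i(T),\varphi_i(T)$ are the numbers of $-$'s and $+$'s in the $i$-signature; $\mathrm{wt}(T)=\sum_{i=1}^{n+1}|T|_i\epsilon_i$, where $|T|_i$ is the number of entries $i$. $\mathcal T'(\lambda)$ is the set of reverse semistandard Young tableaux of shape $\lambda$: fillings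 with entries in $\{1,\dots,n+1\}$ weakly decreasing along rows and strictly decreasing down columns. $\phi:\mathcal T'(\lambda)\to\mathcal T(\lambda)$ is the bijection replacing each entry $a$ by $n+2-a$. Crystal structure on $\mathcal T'(\lambda)$: $\mathrm{wt}(T)=\sum_{i=1}^{n+1}|T|_i\epsilon_i$, $\tilde e_iT=\phi^{-1}(\tilde f_{n+1-i}\phi(T))$, $\tilde f_iT=\phi^{-1}(\tilde e_{n+1-i}\phi(T))$ (with $\phi^{-1}(0)=0$), $\varepsilon_i(T)=\varphi_{n+1-i}(\phi(T))$, $\varphi_i(T)=\varepsilon_{n+1-i}(\phi(T))$. Polyhedral realization. Consider integer sequences $\overrightarrow{x}=(\dots,x_2,x_1)$ with $x_k=0$ for $k\gg0$; write $x_j^{(i)}=x_{(j-1)n+i}$ for $j\ge1$, $i\in I$, with $x_j^{(0)}=0$, and let $\iota=(\dots,i_2,i_1)$ with $i_{(j-1)n+i}=i$. $\Sigma_\iota[\lambda]$ is the set of $\overrightarrow{x}$ with $x_1^{(i)}\ge x_2^{(i-1)}\ge\dots\ge x_i^{(1)}\ge0$ for $1\le i\le n$; $x_j^{(i)}=0$ for $i+j>n+1$; and $\lambda_i-\lambda_{i+1}\ge x_j^{(i-j+1)}-x_j^{(i-j)}$ for $1\le j\le i\le n$. Put $\sigma_k(\overrightarrow{x})=x_k+\sum_{j>k}\langle\alpha_{i_k}^\vee,\alpha_{i_j}\rangle x_j$, $\sigma^{(i)}(\overrightarrow{x})=\max_{k:i_k=i}\sigma_k(\overrightarrow{x})$,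 $M^{(i)}(\overrightarrow{x})=\{k: i_k=i,\ \sigma_k(\overrightarrow{x})=\sigma^{(i)}(\overrightarrow{x})\}$, $\sigma_0^{(i)}(\overrightarrow{x})=-\langle\alpha_i^\vee,\lambda\rangle+\sum_{j\ge1}\langle\alpha_i^\vee,\alpha_{i_j}\rangle x_j$; $\overrightarrow{e_k}$ is the $k$-th unit vector. Crystal structure on $\Sigma_\iota[\lambda]$: $\mathrm{wt}(\overrightarrow{x})=\lambda-\sum_j x_j\alpha_{i_j}$; $\tilde f_i\overrightarrow{x}=\overrightarrow{x}+\overrightarrow{e_k}$, $k=\min M^{(i)}(\overrightarrow{x})$, if $\sigma^{(i)}(\overrightarrow{x})>\sigma_0^{(i)}(\overrightarrow{x})$, and $0$ otherwise; $\tilde e_i\overrightarrow{x}=\overrightarrow{x}-\overrightarrow{e_k}$, $k=\max M^{(i)}(\overrightarrow{x})$, if $\sigma^{(i)}(\overrightarrow{x})\ge\sigma_0^{(i)}(\overrightarrow{x})$ and $\sigma^{(i)}(\overrightarrow{x})>0$, and $0$ otherwise; $\varepsilon_i(\overrightarrow{x})=\max(\sigma^{(i)}(\overrightarrow{x}),\sigma_0^{(i)}(\overrightarrow{x}))$; $\varphi_i(\overrightarrow{x})=\langle\alpha_i^\vee,\mathrm{wt}(\overrightarrow{x})\rangle+\varepsilon_i(\overrightarrow{x})$. The map. For $\overrightarrow{x}\in\Sigma_\iota[\lambda]$ and $1\le i\le n+1$ let $\Lambda_i(\overrightarrow{x})=(x_k^{(i-1)}+\lambda_{k+i-1})_{1\le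 k\le n+2-i}$, and let $\Lambda_{n+2}(\overrightarrow{x})$ be empty. These are Young diagrams with $\lambda=\Lambda_1\supseteq\Lambda_2\supseteq\dots\supseteq\Lambda_{n+1}$, and each $\Lambda_i/\Lambda_{i+1}$ has no two boxes in the same column. $T_{\overrightarrow{x}}$ is the reverse semistandard tableau of shape $\lambda$ in which the boxes of $\Lambda_i(\overrightarrow{x})/\Lambda_{i+1}(\overrightarrow{x})$ are filled with $i$, for $1\le i\le n+1$. *)

theory Defs
  imports Main
begin

section \<open>The weight lattice\<close>

text \<open>
  \<open>P\<close> is free on \<open>\<omega>\<^sub>1, \<dots>, \<omega>\<^sub>n\<close>; a weight is given by its coordinates with respect to this
  basis, as a function on \<open>nat\<close> that vanishes outside \<open>{1..n}\<close>. With \<open>\<omega>\<^sub>0 = \<omega>\<^sub>n\<^sub>+\<^sub>1 = 0\<close> the image of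
  \<open>\<epsilon>\<^sub>j\<close> in \<open>P\<close> (that is, modulo \<open>\<epsilon>\<^sub>1 + \<dots> + \<epsilon>\<^sub>n\<^sub>+\<^sub>1\<close>) is \<open>\<omega>\<^sub>j - \<omega>\<^sub>j\<^sub>-\<^sub>1\<close>.
\<close>

type_synonym weight = "nat \<Rightarrow> int"

definition weight_lattice :: "nat \<Rightarrow> weight set" where
  "weight_lattice n = {p. \<forall>k. k \<notin> {1..n} \<longrightarrow> p k = 0}"

definition dominant_weights :: "nat \<Rightarrow> weight set" where
  "dominant_weights n = {p \<in> weight_lattice n. \<forall>i\<in>{1..n}. 0 \<le> p i}"

definition omega :: "nat \<Rightarrow> nat \<Rightarrow> weight" where
  "omega n i = (\<lambda>k. if k = i \<and> i \<in> {1..n} then 1 else 0)"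

definition epsilon :: "nat \<Rightarrow> nat \<Rightarrow> weight" where
  "epsilon n j = (\<lambda>k. omega n j k - omega n (j - 1) k)"

definition alpha :: "nat \<Rightarrow> nat \<Rightarrow> weight" where
  "alpha n i = (\<lambda>k. epsilon n i k - epsilon n (i + 1) k)"

text \<open>The pairing of the simple coroot \<open>\<alpha>\<^sub>i\<^sup>\<or>\<close> with a weight; see \<open>pairing_epsilon\<close> below.\<close>

definition pairing :: "nat \<Rightarrow> weight \<Rightarrow> int" where
  "pairing i p = p i"

lemma pairing_epsilon:
  assumes "i \<in> {1..n}" "j \<in> {1..n + 1}"
  shows "pairing i (epsilon n j) = (if i = j then 1 else 0) - (if i + 1 = j then 1 else 0)"
  using assms by (auto simp: pairing_def epsilon_def omega_def)

lemma omega_eq_sum_epsilon: "omega n i k = (\<Sum>j=1..i. epsilon n j k)"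
proof (induction i)
  case 0
  then show ?case by (simp add: omega_def)
next
  case (Suc i)
  then show ?case by (simp add: epsilon_def)
qed

lemma sum_epsilon_eq_0: "(\<Sum>j=1..n + 1. epsilon n j k) = 0"
  by (simp only: omega_eq_sum_epsilon[symmetric]) (simp add: omega_def)

text \<open>\<open>\<lambda>\<^sub>i = a\<^sub>i + \<dots> + a\<^sub>n\<close> for \<open>\<lambda> = \<Sum> a\<^sub>i \<omega>\<^sub>i\<close>; in particular \<open>\<lambda>\<^sub>n\<^sub>+\<^sub>1 = 0\<close>.\<close>

definition part :: "nat \<Rightarrow> weight \<Rightarrow> nat \<Rightarrow> int" where
  "part n lam i = (\<Sum>j=i..n. lam j)"


section \<open>Crystals of type \<open>A\<^sub>n\<close>\<close>

datatype int_minf = MInf | Fin int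

primrec shift :: "int_minf \<Rightarrow> int \<Rightarrow> int_minf" where
  "shift MInf m = MInf"
| "shift (Fin k) m = Fin (k + m)"

text \<open>The element \<open>0\<close> adjoined to a crystal is \<open>None\<close>.\<close>

record 'b crystal_data =
  elts :: "'b set"
  wt :: "'b \<Rightarrow> weight"
  et :: "nat \<Rightarrow> 'b \<Rightarrow> 'b option"
  ft :: "nat \<Rightarrow> 'b \<Rightarrow> 'b option"
  eps :: "nat \<Rightarrow> 'b \<Rightarrow> int_minf"
  phi :: "nat \<Rightarrow> 'b \<Rightarrow> int_minf"

definition with_zero :: "'b crystal_data \<Rightarrow> 'b option set" where
  "with_zero B = insert None (Some ` elts B)"

definition is_crystal :: "nat \<Rightarrow> 'b crystal_data \<Rightarrow> bool" where
  "is_crystal n B \<longleftrightarrow>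
    (\<forall>b\<in>elts B. wt B b \<in> weight_lattice n) \<and>
    (\<forall>i\<in>{1..n}. \<forall>b\<in>elts B.
      et B i b \<in> with_zero B \<and>
      ft B i b \<in> with_zero B \<and>
      phi B i b = shift (eps B i b) (pairing i (wt B b)) \<and>
      (\<forall>b'. et B i b = Some b' \<longrightarrow>
        wt B b' = (\<lambda>k. wt B b k + alpha n i k) \<and>
        eps B i b' = shift (eps B i b) (- 1) \<and>
        phi B i b' = shift (phi B i b) 1) \<and>
      (\<forall>b'. ft B i b = Some b' \<longrightarrow>
        wt B b' = (\<lambda>k. wt B b k - alpha n i k) \<and>
        eps B i b' = shift (eps B i b) 1 \<and>
        phi B i b' = shift (phi B i b) (- 1)) \<and>
      (\<forall>b'\<in>elts B. ft B i b = Some b' \<longleftrightarrow> et B i b' = Some b) \<and>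
      (phi B i b = MInf \<longrightarrow> et B i b = None \<and> ft B i b = None))"

text \<open>The operators are extended to \<open>B \<union> {0}\<close> by \<open>0 \<mapsto> 0\<close>, which is what \<open>Option.bind\<close> does.\<close>

definition crystal_iso ::
  "nat \<Rightarrow> 'b crystal_data \<Rightarrow> 'c crystal_data \<Rightarrow> ('b option \<Rightarrow> 'c option) \<Rightarrow> bool" where
  "crystal_iso n B1 B2 \<Psi> \<longleftrightarrow>
    is_crystal n B1 \<and> is_crystal n B2 \<and>
    bij_betw \<Psi> (with_zero B1) (with_zero B2) \<and>
    \<Psi> None = None \<and>
    (\<forall>b\<in>elts B1. \<forall>b'. \<Psi> (Some b) = Some b' \<longrightarrow>
      wt B2 b' = wt B1 b \<and>
      (\<forall>i\<in>{1..n}. eps B2 i b' = eps B1 i b \<and> phi B2 i b' = phi B1 i b)) \<and>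
    (\<forall>i\<in>{1..n}. \<forall>u\<in>with_zero B1.
      \<Psi> (Option.bind u (et B1 i)) = Option.bind (\<Psi> u) (et B2 i) \<and>
      \<Psi> (Option.bind u (ft B1 i)) = Option.bind (\<Psi> u) (ft B2 i))"


section \<open>Tableaux\<close>

text \<open>
  Boxes are pairs (row, column), both counted from 1. A filling of a diagram is a function on all
  boxes that is \<open>0\<close> outside the diagram.
\<close>

type_synonym box = "nat \<times> nat"
type_synonym filling = "box \<Rightarrow> nat"

definition diagram :: "nat \<Rightarrow> (nat \<Rightarrow> int) \<Rightarrow> box set" where
  "diagram m \<mu> = {(r, c). 1 \<le> r \<and> r \<le> m \<and> 1 \<le> c \<and> int c \<le> \<mu> r}"

definition young :: "nat \<Rightarrow> weight \<Rightarrow> box set" where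
  "young n lam = diagram n (part n lam)"

definition fillings :: "nat \<Rightarrow> weight \<Rightarrow> filling set" where
  "fillings n lam =
    {T. (\<forall>b\<in>young n lam. T b \<in> {1..n + 1}) \<and> (\<forall>b. b \<notin> young n lam \<longrightarrow> T b = 0)}"

definition ssyt :: "nat \<Rightarrow> weight \<Rightarrow> filling set" where
  "ssyt n lam = {T \<in> fillings n lam.
    (\<forall>r c. (r, c) \<in> young n lam \<and> (r, c + 1) \<in> young n lam \<longrightarrow> T (r, c) \<le> T (r, c + 1)) \<and>
    (\<forall>r c. (r, c) \<in> young n lam \<and> (r + 1, c) \<in> young n lam \<longrightarrow> T (r, c) < T (r + 1, c))}"

definition reverse_ssyt :: "nat \<Rightarrow> weight \<Rightarrow> filling set" where
  "reverse_ssyt n lam = {T \<in> fillings n lam.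
    (\<forall>r c. (r, c) \<in> young n lam \<and> (r, c + 1) \<in> young n lam \<longrightarrow> T (r, c) \<ge> T (r, c + 1)) \<and>
    (\<forall>r c. (r, c) \<in> young n lam \<and> (r + 1, c) \<in> young n lam \<longrightarrow> T (r, c) > T (r + 1, c))}"

definition tableau_wt :: "nat \<Rightarrow> weight \<Rightarrow> filling \<Rightarrow> weight" where
  "tableau_wt n lam T =
    (\<lambda>k. \<Sum>i=1..n + 1. int (card {b \<in> young n lam. T b = i}) * epsilon n i k)"

text \<open>Far-Eastern reading: columns from right to left, each column from top to bottom.\<close>

definition reading :: "nat \<Rightarrow> weight \<Rightarrow> box list" where
  "reading n lam =
    concat (map (\<lambda>c. filter (\<lambda>b. b \<in> young n lam) (map (\<lambda>r. (r, c)) [1..<n + 1]))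
      (rev [1..<nat (part n lam 1) + 1]))"

datatype sign = Plus | Minus

text \<open>
  Each sign is kept together with the box it comes from. \<open>cancel\<close> removes the \<open>(+,-)\<close> pairs
  working from the right; \<open>cancel_reachable\<close> and \<open>cancel_normal\<close> confirm that its result comes from
  successive cancellations of neighbouring pairs and admits no further one.
\<close>

definition signs :: "nat \<Rightarrow> filling \<Rightarrow> box list \<Rightarrow> (sign \<times> box) list" where
  "signs i T bs =
    concat (map (\<lambda>b. if T b = i then [(Plus, b)] else if T b = i + 1 then [(Minus, b)] else []) bs)"

fun cancel_cons :: "sign \<times> 'a \<Rightarrow> (sign \<times> 'a) list \<Rightarrow> (sign \<times> 'a) list" where
  "cancel_cons (Plus, b) ((Minus, b') # ys) = ys"
| "cancel_cons x ys = x # ys"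

definition cancel :: "(sign \<times> 'a) list \<Rightarrow> (sign \<times> 'a) list" where
  "cancel xs = foldr cancel_cons xs []"

inductive cancel_step :: "(sign \<times> 'a) list \<Rightarrow> (sign \<times> 'a) list \<Rightarrow> bool" where
  "cancel_step (xs @ [(Plus, b), (Minus, b')] @ ys) (xs @ ys)"

lemma cancel_step_Cons: "cancel_step xs ys \<Longrightarrow> cancel_step (x # xs) (x # ys)"
  by (induction rule: cancel_step.induct) (metis append_Cons cancel_step.intros)

lemma cancel_reachable: "cancel_step\<^sup>*\<^sup>* xs (cancel xs)"
proof (induction xs)
  case Nil
  then show ?case by (simp add: cancel_def)
next
  case (Cons x xs)
  from Cons.IH have 1: "cancel_step\<^sup>*\<^sup>* (x # xs) (x # cancel xs)"
    by (induction rule: rtranclp_induct) (auto intro: cancel_step_Cons rtranclp.rtrancl_into_rtrancl)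
  have 2: "cancel_step\<^sup>*\<^sup>* (x # zs) (cancel_cons x zs)" for zs :: "(sign \<times> 'a) list"
    using cancel_step.intros[of "[]"]
    by (cases "(x, zs)" rule: cancel_cons.cases) (auto intro!: r_into_rtranclp[of cancel_step])
  show ?case using rtranclp_trans[OF 1 2] by (simp add: cancel_def)
qed

lemma cancel_form:
  "\<exists>us vs. cancel xs = map (Pair Minus) us @ map (Pair Plus) vs"
proof (induction xs)
  case Nil
  then show ?case by (simp add: cancel_def)
next
  case (Cons x xs)
  then obtain us vs where eq: "cancel xs = map (Pair Minus) us @ map (Pair Plus) vs" by blast
  obtain s b where x: "x = (s, b)" by (cases x)
  have step: "cancel (x # xs) = cancel_cons (s, b) (map (Pair Minus) us @ map (Pair Plus) vs)"
    by (simp add: cancel_def x eq[unfolded cancel_def])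
  show ?case
  proof (cases s)
    case Minus
    then have "cancel (x # xs) = map (Pair Minus) (b # us) @ map (Pair Plus) vs"
      by (simp add: step)
    then show ?thesis by blast
  next
    case Plus
    show ?thesis
    proof (cases us)
      case Nil
      have "cancel (x # xs) = map (Pair Minus) [] @ map (Pair Plus) (b # vs)"
        by (cases vs) (simp_all add: step Plus Nil)
      then show ?thesis by blast
    next
      case (Cons u us')
      then have "cancel (x # xs) = map (Pair Minus) us' @ map (Pair Plus) vs"
        by (simp add: step Plus)
      then show ?thesis by blast
    qed
  qed
qed

lemma cancel_normal: "\<not> cancel_step (cancel xs) ys"
proof
  assume "cancel_step (cancel xs) ys"
  then obtain as b b' bs where eq: "cancel xs = as @ [(Plus, b), (Minus, b')] @ bs"
    by (auto elim: cancel_step.cases)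
  obtain us vs where "cancel xs = map (Pair Minus) us @ map (Pair Plus) vs"
    using cancel_form by blast
  with eq have form: "map (Pair Minus) us @ map (Pair Plus) vs = as @ [(Plus, b), (Minus, b')] @ bs"
    by simp
  then have "map (Pair Minus) us @ map (Pair Plus) vs = (as @ [(Plus, b)]) @ ((Minus, b') # bs)"
    by simp
  then consider cs where "map (Pair Minus) us = (as @ [(Plus, b)]) @ cs"
    | cs where "map (Pair Plus) vs = cs @ ((Minus, b') # bs)"
    unfolding append_eq_append_conv2 by blast
  then show False
  proof cases
    case 1
    then have "(Plus, b) \<in> set (map (Pair Minus) us)" by simp
    then show False by auto
  next
    case 2
    then have "(Minus, b') \<in> set (map (Pair Plus) vs)" by simp
    then show False by auto
  qed
qed

definition signature :: "nat \<Rightarrow> weight \<Rightarrow> nat \<Rightarrow> filling \<Rightarrow> (sign \<times> box) list" where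
  "signature n lam i T = cancel (signs i T (reading n lam))"

definition boxes_of :: "sign \<Rightarrow> (sign \<times> box) list \<Rightarrow> box list" where
  "boxes_of s xs = map snd (filter (\<lambda>x. fst x = s) xs)"

definition tableau_f :: "nat \<Rightarrow> weight \<Rightarrow> nat \<Rightarrow> filling \<Rightarrow> filling option" where
  "tableau_f n lam i T =
    (let bs = boxes_of Plus (signature n lam i T)
     in if bs = [] then None else Some (T(hd bs := i + 1)))"

definition tableau_e :: "nat \<Rightarrow> weight \<Rightarrow> nat \<Rightarrow> filling \<Rightarrow> filling option" where
  "tableau_e n lam i T =
    (let bs = boxes_of Minus (signature n lam i T)
     in if bs = [] then None else Some (T(last bs := i)))"

definition ssyt_crystal :: "nat \<Rightarrow> weight \<Rightarrow> filling crystal_data" where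
  "ssyt_crystal n lam =
    \<lparr> elts = ssyt n lam,
      wt = tableau_wt n lam,
      et = tableau_e n lam,
      ft = tableau_f n lam,
      eps = (\<lambda>i T. Fin (int (length (boxes_of Minus (signature n lam i T))))),
      phi = (\<lambda>i T. Fin (int (length (boxes_of Plus (signature n lam i T))))) \<rparr>"

definition flip :: "nat \<Rightarrow> weight \<Rightarrow> filling \<Rightarrow> filling" where
  "flip n lam T = (\<lambda>b. if b \<in> young n lam then n + 2 - T b else 0)"

definition unflip :: "nat \<Rightarrow> weight \<Rightarrow> filling \<Rightarrow> filling" where
  "unflip n lam = the_inv_into (reverse_ssyt n lam) (flip n lam)"

definition reverse_ssyt_crystal :: "nat \<Rightarrow> weight \<Rightarrow> filling crystal_data" where
  "reverse_ssyt_crystal n lam =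
    (let S = ssyt_crystal n lam in
    \<lparr> elts = reverse_ssyt n lam,
      wt = tableau_wt n lam,
      et = (\<lambda>i T. map_option (unflip n lam) (ft S (n + 1 - i) (flip n lam T))),
      ft = (\<lambda>i T. map_option (unflip n lam) (et S (n + 1 - i) (flip n lam T))),
      eps = (\<lambda>i T. phi S (n + 1 - i) (flip n lam T)),
      phi = (\<lambda>i T. eps S (n + 1 - i) (flip n lam T)) \<rparr>)"


section \<open>The polyhedral realization\<close>

text \<open>
  A sequence \<open>(\<dots>, x\<^sub>2, x\<^sub>1)\<close> is a function on \<open>nat\<close> whose unused value at index 0 is fixed to be 0.
\<close>

definition sequences :: "(nat \<Rightarrow> int) set" where
  "sequences = {x. x 0 = 0 \<and> finite {k. x k \<noteq> 0}}"

text \<open>\<open>xc n x j i\<close> is \<open>x\<^sub>j\<^sup>(\<^sup>i\<^sup>)\<close>, and \<open>iota n k\<close> is \<open>i\<^sub>k\<close>.\<close>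

definition xc :: "nat \<Rightarrow> (nat \<Rightarrow> int) \<Rightarrow> nat \<Rightarrow> nat \<Rightarrow> int" where
  "xc n x j i = (if i = 0 then 0 else x ((j - 1) * n + i))"

definition iota :: "nat \<Rightarrow> nat \<Rightarrow> nat" where
  "iota n k = (k - 1) mod n + 1"

lemma iota_index: "1 \<le> j \<Longrightarrow> i \<in> {1..n} \<Longrightarrow> iota n ((j - 1) * n + i) = i"
  by (cases i) (auto simp: iota_def)

definition Sigma_set :: "nat \<Rightarrow> weight \<Rightarrow> (nat \<Rightarrow> int) set" where
  "Sigma_set n lam = {x \<in> sequences.
    (\<forall>i\<in>{1..n}. (\<forall>j\<in>{1..<i}. xc n x j (i - j + 1) \<ge> xc n x (j + 1) (i - j)) \<and> xc n x i 1 \<ge> 0) \<and>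
    (\<forall>i\<in>{1..n}. \<forall>j\<ge>1. i + j > n + 1 \<longrightarrow> xc n x j i = 0) \<and>
    (\<forall>i\<in>{1..n}. \<forall>j\<in>{1..i}.
      part n lam i - part n lam (i + 1) \<ge> xc n x j (i - j + 1) - xc n x j (i - j))}"

definition sigma :: "nat \<Rightarrow> (nat \<Rightarrow> int) \<Rightarrow> nat \<Rightarrow> int" where
  "sigma n x k =
    x k + (\<Sum>j | j > k \<and> x j \<noteq> 0. pairing (iota n k) (alpha n (iota n j)) * x j)"

definition positions :: "nat \<Rightarrow> nat \<Rightarrow> nat set" where
  "positions n i = {k. 1 \<le> k \<and> iota n k = i}"

text \<open>For finitely supported \<open>x\<close> the set of values is finite (almost all of them are 0).\<close>

definition sigma_max :: "nat \<Rightarrow> nat \<Rightarrow> (nat \<Rightarrow> int) \<Rightarrow> int" where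
  "sigma_max n i x = Max (sigma n x ` positions n i)"

definition sigma_argmax :: "nat \<Rightarrow> nat \<Rightarrow> (nat \<Rightarrow> int) \<Rightarrow> nat set" where
  "sigma_argmax n i x = {k \<in> positions n i. sigma n x k = sigma_max n i x}"

definition sigma_zero :: "nat \<Rightarrow> weight \<Rightarrow> nat \<Rightarrow> (nat \<Rightarrow> int) \<Rightarrow> int" where
  "sigma_zero n lam i x =
    - pairing i lam + (\<Sum>j | j \<ge> 1 \<and> x j \<noteq> 0. pairing i (alpha n (iota n j)) * x j)"

definition Sigma_wt :: "nat \<Rightarrow> weight \<Rightarrow> (nat \<Rightarrow> int) \<Rightarrow> weight" where
  "Sigma_wt n lam x =
    (\<lambda>k. lam k - (\<Sum>j | j \<ge> 1 \<and> x j \<noteq> 0. x j * alpha n (iota n j) k))"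

text \<open>
  \<open>sigma_argmax\<close> may be infinite when the maximum is 0, hence \<open>LEAST\<close> rather than \<open>Min\<close> below;
  when the maximum is positive it is finite, so \<open>Max\<close> is meaningful.
\<close>

definition Sigma_f :: "nat \<Rightarrow> weight \<Rightarrow> nat \<Rightarrow> (nat \<Rightarrow> int) \<Rightarrow> (nat \<Rightarrow> int) option" where
  "Sigma_f n lam i x =
    (if sigma_max n i x > sigma_zero n lam i x
     then let k = (LEAST k. k \<in> sigma_argmax n i x) in Some (x(k := x k + 1))
     else None)"

definition Sigma_e :: "nat \<Rightarrow> weight \<Rightarrow> nat \<Rightarrow> (nat \<Rightarrow> int) \<Rightarrow> (nat \<Rightarrow> int) option" where
  "Sigma_e n lam i x =
    (if sigma_max n i x \<ge> sigma_zero n lam i x \<and> sigma_max n i x > 0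
     then let k = Max (sigma_argmax n i x) in Some (x(k := x k - 1))
     else None)"

definition Sigma_eps :: "nat \<Rightarrow> weight \<Rightarrow> nat \<Rightarrow> (nat \<Rightarrow> int) \<Rightarrow> int" where
  "Sigma_eps n lam i x = max (sigma_max n i x) (sigma_zero n lam i x)"

definition Sigma_crystal :: "nat \<Rightarrow> weight \<Rightarrow> (nat \<Rightarrow> int) crystal_data" where
  "Sigma_crystal n lam =
    \<lparr> elts = Sigma_set n lam,
      wt = Sigma_wt n lam,
      et = Sigma_e n lam,
      ft = Sigma_f n lam,
      eps = (\<lambda>i x. Fin (Sigma_eps n lam i x)),
      phi = (\<lambda>i x. Fin (pairing i (Sigma_wt n lam x) + Sigma_eps n lam i x)) \<rparr>"


section \<open>The map \<open>x \<mapsto> T\<^sub>x\<close>\<close>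

text \<open>For \<open>i = n + 2\<close> this is the empty diagram, since it has no rows.\<close>

definition Lam :: "nat \<Rightarrow> weight \<Rightarrow> (nat \<Rightarrow> int) \<Rightarrow> nat \<Rightarrow> box set" where
  "Lam n lam x i = diagram (n + 2 - i) (\<lambda>k. xc n x k (i - 1) + part n lam (k + i - 1))"

definition psi :: "nat \<Rightarrow> weight \<Rightarrow> (nat \<Rightarrow> int) \<Rightarrow> filling" where
  "psi n lam x = (\<lambda>b. if b \<in> young n lam
    then THE i. i \<in> {1..n + 1} \<and> b \<in> Lam n lam x i - Lam n lam x (i + 1)
    else 0)"

end

theory Submission
  imports Defs
begin

text \<open>
  Both crystals are governed by the same family of integers. Fix \<open>i\<close>, give the entries \<open>i + 1\<close> and
  \<open>i\<close> of a reverse tableau \<open>T\<close> the signs \<open>+1\<close> and \<open>-1\<close>, all other entries the sign \<open>0\<close>, and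
  call the sum of the signs over a final segment of the Far-Eastern reading the height of that
  segment. The flip \<open>a \<mapsto> n + 2 - a\<close> turns these signs into the \<open>+\<close> and \<open>-\<close> used for the index
  \<open>n + 1 - i\<close> on ordinary tableaux.

  Cancelling pairs is a statement about heights (\<open>cancel_by_heights\<close>): with \<open>N\<close> the largest height,
  \<open>N\<close> is the number of surviving \<open>+\<close>; the first surviving \<open>+\<close> opens the shortest final segment of
  height \<open>N\<close>, and the last surviving \<open>-\<close> immediately precedes the longest one. Hence
  \<open>\<epsilon>\<^sub>i(T) = N\<close>, \<open>\<phi>\<^sub>i(T) = N - h\<close> with \<open>h\<close> the height of the whole reading, and the box changed by an
  operator is described by extremality of heights alone (\<open>f_step\<close>, \<open>e_step\<close>). In this description
  the two operators are visibly inverse to each other, the changed filling is again a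
  reverse tableau, and all crystal axioms become arithmetic (\<open>reverse_ssyt_is_crystal\<close>).

  A sequence \<open>x\<close> is a Gelfand-Tsetlin pattern in disguise: the number of entries \<open>\<ge> i\<close> in row \<open>r\<close>
  of \<open>T\<^sub>x\<close> is \<open>g\<^sub>i(r) = x\<^sub>r\<^sup>(\<^sup>i\<^sup>-\<^sup>1\<^sup>) + \<lambda>\<^sub>r\<^sub>+\<^sub>i\<^sub>-\<^sub>1\<close>, and the inequalities defining \<open>\<Sigma>\<^sub>\<iota>[\<lambda>]\<close> are
  the interlacing conditions for these numbers (\<open>psi_bij\<close>). The heart of the matter is
  \<open>sigma_eq_height\<close>: \<open>\<sigma>\<^sub>k(x)\<close> for the position \<open>k\<close> of \<open>x\<^sub>s\<^sup>(\<^sup>i\<^sup>)\<close> is the height of the final segment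
  that starts at the last entry \<open>\<ge> i + 1\<close> of row \<open>s\<close> (empty if there is none); likewise
  \<open>\<sigma>\<^sub>0\<^sup>(\<^sup>i\<^sup>)(x)\<close> is the height of the whole reading. The segment of maximal height chosen by \<open>e\<^sub>i\<close> or \<open>f\<^sub>i\<close> on tableaux is always one
  of these (\<open>e_step_at_row_end\<close>, \<open>f_step_after_row_end\<close>), so the maxima agree, and the shortest and
  longest maximal segments correspond to the largest and smallest maximising \<open>k\<close>. Changing
  \<open>x\<^sub>s\<^sup>(\<^sup>i\<^sup>)\<close> by one moves the boundary between the entries \<open>i\<close> and \<open>i + 1\<close> of row \<open>s\<close> by one box,
  which is exactly the change made on the tableau. Thus \<open>\<psi>\<close> commutes with the operators, and
  the crystal axioms for \<open>\<Sigma>\<^sub>\<iota>[\<lambda>]\<close> are inherited through the bijection (\<open>crystal_isoI\<close>).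
\<close>

section \<open>Heights of sign words\<close>

definition word_height :: "(sign \<times> 'a) list \<Rightarrow> int" where
  "word_height xs = (\<Sum>x\<leftarrow>xs. case fst x of Plus \<Rightarrow> 1 | Minus \<Rightarrow> - 1)"

lemma word_height_simps [simp]:
  "word_height [] = 0"
  "word_height (x # xs) = (case fst x of Plus \<Rightarrow> 1 | Minus \<Rightarrow> - 1) + word_height xs"
  "word_height (xs @ ys) = word_height xs + word_height ys"
  by (simp_all add: word_height_def)

text \<open>
  The positions of the surviving signs in terms of heights of suffixes, in the form in which it is
  preserved when a sign is put in front of the word: \<open>us\<close> and \<open>vs\<close> carry the surviving \<open>-\<close> and
  \<open>+\<close>. The last two clauses say that the first surviving \<open>+\<close> opens the shortest suffix of maximal
  height and that the last surviving \<open>-\<close> immediately precedes the longest one.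
\<close>

definition signature_heights :: "(sign \<times> 'a) list \<Rightarrow> 'a list \<Rightarrow> 'a list \<Rightarrow> bool" where
  "signature_heights xs us vs \<longleftrightarrow>
    cancel xs = map (Pair Minus) us @ map (Pair Plus) vs \<and>
    word_height xs = int (length vs) - int (length us) \<and>
    (\<forall>as zs. xs = as @ zs \<longrightarrow> word_height zs \<le> int (length vs)) \<and>
    (vs \<noteq> [] \<longrightarrow> (\<exists>as bs. xs = as @ (Plus, hd vs) # bs \<and> word_height bs = int (length vs) - 1 \<and>
      (\<forall>cs zs. bs = cs @ zs \<longrightarrow> word_height zs < int (length vs)))) \<and>
    (us \<noteq> [] \<longrightarrow> (\<exists>as bs. xs = as @ (Minus, last us) # bs \<and> word_height bs = int (length vs) \<and>
      (\<forall>cs ds. as = cs @ ds \<longrightarrow>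
        word_height (ds @ (Minus, last us) # bs) < int (length vs))))"

text \<open>
  Prepending a sign adds a single suffix, the whole word. Let \<open>N\<close> be the old maximal height and \<open>u\<close>
  the number of surviving \<open>-\<close>; the old word has height \<open>N - u\<close>. A \<open>+\<close> raises the maximum exactly if
  \<open>u = 0\<close>, and then survives and opens the only suffix of height \<open>N + 1\<close>. If \<open>u > 0\<close>, it cancels the
  first surviving \<open>-\<close> and the whole word has height \<open>N\<close> only if none is left. A prepended \<open>-\<close> makes the
  whole word too low to matter; for \<open>u = 0\<close> it precedes the old word, which has height \<open>N\<close>.
\<close>

lemma cancel_by_heights: "\<exists>us vs. signature_heights xs us vs"
proof (induction xs)
  case Nil
  show ?case by (intro exI[of _ "[]"]) (simp add: signature_heights_def cancel_def)
next
  case (Cons x xs)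
  then obtain us vs where IH: "signature_heights xs us vs" by blast
  note IH = IH[unfolded signature_heights_def]
  have eq: "cancel xs = map (Pair Minus) us @ map (Pair Plus) vs"
    and total: "word_height xs = int (length vs) - int (length us)"
    and bound: "\<And>as zs. xs = as @ zs \<Longrightarrow> word_height zs \<le> int (length vs)"
    using IH by simp_all
  have first_plus: "\<exists>as bs. xs = as @ (Plus, hd vs) # bs \<and>
      word_height bs = int (length vs) - 1 \<and>
      (\<forall>cs zs. bs = cs @ zs \<longrightarrow> word_height zs < int (length vs))" if "vs \<noteq> []"
    using IH that by (elim conjE) (rule mp)
  have last_minus: "\<exists>as bs. xs = as @ (Minus, last us) # bs \<and>
      word_height bs = int (length vs) \<and>
      (\<forall>cs ds. as = cs @ ds \<longrightarrow>
        word_height (ds @ (Minus, last us) # bs) < int (length vs))" if "us \<noteq> []"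
    using IH that by (elim conjE) (rule mp)
  obtain s b where x: "x = (s, b)" by (cases x)
  have step: "cancel (x # xs) = cancel_cons (s, b) (map (Pair Minus) us @ map (Pair Plus) vs)"
    by (simp add: cancel_def x eq[unfolded cancel_def])
  have bound': "word_height zs \<le> max (int (length vs)) (word_height (x # xs))"
    if "x # xs = as @ zs" for as zs
    using that bound by (cases as) (auto simp: le_max_iff_disj)
  have first_plus': "\<exists>as bs. x # xs = as @ (Plus, hd vs) # bs \<and>
      word_height bs = int (length vs) - 1 \<and>
      (\<forall>cs zs. bs = cs @ zs \<longrightarrow> word_height zs < int (length vs))" if "vs \<noteq> []"
    using first_plus[OF that] by (metis append_Cons)
  have last_minus': "\<exists>as bs. x # xs = as @ (Minus, last us) # bs \<and>
      word_height bs = int (length vs) \<and>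
      (\<forall>cs ds. as = cs @ ds \<longrightarrow>
        word_height (ds @ (Minus, last us) # bs) < int (length vs))"
    if ne: "us \<noteq> []" and low: "word_height (x # xs) < int (length vs)"
  proof -
    obtain as bs where *: "xs = as @ (Minus, last us) # bs" "word_height bs = int (length vs)"
      and long: "\<And>cs ds. as = cs @ ds \<Longrightarrow>
        word_height (ds @ (Minus, last us) # bs) < int (length vs)"
      using last_minus[OF ne] by blast
    have "word_height (ds @ (Minus, last us) # bs) < int (length vs)" if "x # as = cs @ ds" for cs ds
    proof (cases cs)
      case Nil
      then show ?thesis using that low *(1) by auto
    next
      case (Cons c cs')
      then show ?thesis using that long by auto
    qed
    then show ?thesis using * by (intro exI[of _ "x # as"] exI[of _ bs]) auto
  qed
  show ?case
  proof (cases s)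
    case Minus
    have hx: "word_height (x # xs) = word_height xs - 1" by (simp add: x Minus)
    have last': "\<exists>as bs. x # xs = as @ (Minus, last (b # us)) # bs \<and>
      word_height bs = int (length vs) \<and>
      (\<forall>cs ds. as = cs @ ds \<longrightarrow>
        word_height (ds @ (Minus, last (b # us)) # bs) < int (length vs))"
    proof (cases "us = []")
      case True
      then show ?thesis
        by (intro exI[of _ "[]"] exI[of _ xs]) (simp add: x Minus total)
    next
      case False
      then show ?thesis using last_minus' total hx by simp
    qed
    have "cancel (x # xs) = map (Pair Minus) (b # us) @ map (Pair Plus) vs"
      by (simp add: step Minus)
    moreover have "word_height (x # xs) = int (length vs) - int (length (b # us))"
      using hx total by simp
    moreover have "word_height zs \<le> int (length vs)" if "x # xs = as @ zs" for as zs
      using bound'[OF that] hx total by simp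
    ultimately show ?thesis using first_plus' last'
      by (intro exI[of _ "b # us"] exI[of _ vs])
        (unfold signature_heights_def, intro conjI allI impI)
  next
    case Plus
    have hx: "word_height (x # xs) = word_height xs + 1" by (simp add: x Plus)
    show ?thesis
    proof (cases us)
      case Nil
      have "cancel (x # xs) = map (Pair Minus) [] @ map (Pair Plus) (b # vs)"
        by (cases vs) (simp_all add: step Plus Nil)
      moreover have "word_height (x # xs) = int (length (b # vs)) - int (length [])"
        using hx total Nil by simp
      moreover have "word_height zs \<le> int (length (b # vs))" if "x # xs = as @ zs" for as zs
        using bound'[OF that] hx total Nil by simp
      moreover have "\<exists>as bs. x # xs = as @ (Plus, hd (b # vs)) # bs \<and>
          word_height bs = int (length (b # vs)) - 1 \<and>
          (\<forall>cs zs. bs = cs @ zs \<longrightarrow> word_height zs < int (length (b # vs)))"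
      proof (intro exI conjI allI impI)
        show "x # xs = [] @ (Plus, hd (b # vs)) # xs" by (simp add: x Plus)
        show "word_height xs = int (length (b # vs)) - 1" using total Nil by simp
        show "word_height zs < int (length (b # vs))" if "xs = cs @ zs" for cs zs
          using bound[OF that] by simp
      qed
      ultimately show ?thesis
        by (intro exI[of _ "[]"] exI[of _ "b # vs"])
          (unfold signature_heights_def, intro conjI allI impI, simp_all)
    next
      case (Cons u us')
      have "cancel (x # xs) = map (Pair Minus) us' @ map (Pair Plus) vs"
        by (simp add: step Plus Cons)
      moreover have total': "word_height (x # xs) = int (length vs) - int (length us')"
        using hx total Cons by simp
      moreover have "word_height zs \<le> int (length vs)" if "x # xs = as @ zs" for as zs
        using bound'[OF that] total' by simp
      moreover have "\<exists>as bs. x # xs = as @ (Minus, last us') # bs \<and>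
          word_height bs = int (length vs) \<and>
          (\<forall>cs ds. as = cs @ ds \<longrightarrow>
            word_height (ds @ (Minus, last us') # bs) < int (length vs))" if "us' \<noteq> []"
        using last_minus' total' that Cons by simp
      ultimately show ?thesis using first_plus'
        by (intro exI[of _ us'] exI[of _ vs])
          (unfold signature_heights_def, intro conjI allI impI)
    qed
  qed
qed


section \<open>The reading order\<close>

text \<open>
  \<open>later b q\<close> means that \<open>q\<close> comes strictly after \<open>b\<close> in the Far-Eastern reading. The order is used on
  all pairs, not only on boxes of the diagram, so that final segments of the reading can be
  named by arbitrary pairs.
\<close>

definition later :: "box \<Rightarrow> box \<Rightarrow> bool" where
  "later b q \<longleftrightarrow> snd q < snd b \<or> (snd q = snd b \<and> fst b < fst q)"

definition tail_of :: "nat \<Rightarrow> weight \<Rightarrow> box \<Rightarrow> box set" where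
  "tail_of n lam q = {b \<in> young n lam. \<not> later b q}"

lemma later_linear: "later p q \<or> p = q \<or> later q p"
  by (cases p; cases q) (auto simp: later_def)

lemma later_asym: "later p q \<Longrightarrow> \<not> later q p"
  by (auto simp: later_def)

lemma later_irrefl: "\<not> later p p"
  by (auto simp: later_def)

lemma later_trans: "later p q \<Longrightarrow> later q r \<Longrightarrow> later p r"
  by (auto simp: later_def)

lemma part_antimono:
  assumes "lam \<in> dominant_weights n" "i \<le> j"
  shows "part n lam j \<le> part n lam i"
  unfolding part_def
proof (rule sum_mono2)
  fix k assume "k \<in> {i..n} - {j..n}"
  then show "0 \<le> lam k"
    using assms(1) by (cases "k = 0") (auto simp: dominant_weights_def weight_lattice_def)
qed (use assms(2) in auto)

lemma finite_young:
  assumes "lam \<in> dominant_weights n"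
  shows "finite (young n lam)"
proof (rule finite_subset)
  show "young n lam \<subseteq> {0..n} \<times> {0..nat (part n lam 1)}"
    using part_antimono[OF assms, of 1] by (force simp: young_def diagram_def)
qed simp

lemma set_reading:
  assumes "lam \<in> dominant_weights n"
  shows "set (reading n lam) = young n lam"
proof -
  have "c < nat (part n lam 1) + 1 \<and> 1 \<le> c \<and> 1 \<le> r \<and> r < n + 1" if "(r, c) \<in> young n lam" for r c
    using that part_antimono[OF assms, of 1 r] by (auto simp: young_def diagram_def)
  then show ?thesis by (fastforce simp: reading_def)
qed

lemma sorted_reading: "sorted_wrt later (reading n lam)"
proof -
  have column: "sorted_wrt later (filter P (map (\<lambda>r. (r, c)) [1..<n + 1]))" for P c
    by (intro sorted_wrt_filter)
      (simp add: sorted_wrt_map later_def strict_sorted_iff[symmetric] del: upt_Suc)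
  have "sorted_wrt later (concat (map (\<lambda>c. filter P (map (\<lambda>r. (r, c)) [1..<n + 1])) cs))"
    if "sorted_wrt (>) cs" for P cs
    using that
  proof (induction cs)
    case Nil
    then show ?case by simp
  next
    case (Cons c cs)
    have "later b q" if "b \<in> set (filter P (map (\<lambda>r. (r, c)) [1..<n + 1]))"
      and "q \<in> set (concat (map (\<lambda>c. filter P (map (\<lambda>r. (r, c)) [1..<n + 1])) cs))" for b q
      using that Cons.prems by (auto simp: later_def)
    then show ?case
      using Cons column[of P c] by (simp add: sorted_wrt_append del: set_upt upt_Suc)
  qed
  moreover have "sorted_wrt (>) (rev [1..<m])" for m :: nat
    by (simp add: sorted_wrt_rev)
  ultimately show ?thesis unfolding reading_def by blast
qed

lemma filter_split_tail:
  assumes "sorted_wrt later bs"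
  shows "bs = filter (\<lambda>b. later b q) bs @ filter (\<lambda>b. \<not> later b q) bs"
  using assms
proof (induction bs)
  case Nil
  then show ?case by simp
next
  case (Cons b bs)
  show ?case
  proof (cases "later b q")
    case True
    then show ?thesis using Cons by simp
  next
    case False
    then have "\<not> later b' q" if "b' \<in> set bs" for b'
      using that Cons.prems later_linear[of b q] later_trans later_asym
      by (metis sorted_wrt.simps(2))
    then show ?thesis using False by (simp add: filter_id_conv)
  qed
qed

lemma distinct_if_sorted: "sorted_wrt later bs \<Longrightarrow> distinct bs"
  by (induction bs) (auto simp: later_def)

text \<open>
  Since \<open>(r + 1, c)\<close> is the immediate successor of \<open>(r, c)\<close> among all pairs, the part of the
  reading strictly after a box is again named by a pair.
\<close>

lemma reading_split:
  assumes "lam \<in> dominant_weights n" "reading n lam = as @ (r, c) # bs"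
  shows "set bs = tail_of n lam (r + 1, c)" "set ((r, c) # bs) = tail_of n lam (r, c)"
proof -
  have sorted: "sorted_wrt later (as @ (r, c) # bs)"
    using sorted_reading[of n lam] assms(2) by simp
  have Y: "young n lam = set (as @ (r, c) # bs)"
    using set_reading[OF assms(1)] assms(2) by simp
  from sorted have before: "later b (r, c)" if "b \<in> set as" for b
    using that by (auto simp: sorted_wrt_append)
  from sorted have after: "later (r, c) b" if "b \<in> set bs" for b
    using that by (auto simp: sorted_wrt_append)
  show "set ((r, c) # bs) = tail_of n lam (r, c)"
    unfolding tail_of_def Y using before after later_asym later_irrefl by auto
  show "set bs = tail_of n lam (r + 1, c)"
  proof (intro set_eqI iffI)
    fix b assume "b \<in> set bs"
    then show "b \<in> tail_of n lam (r + 1, c)"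
      using after[of b] by (auto simp: tail_of_def Y later_def)
  next
    fix b assume b: "b \<in> tail_of n lam (r + 1, c)"
    then have "\<not> later b (r, c)" "b \<noteq> (r, c)" by (auto simp: tail_of_def later_def)
    moreover have "b \<notin> set as" using before[of b] \<open>\<not> later b (r, c)\<close> by blast
    ultimately show "b \<in> set bs" using b by (auto simp: tail_of_def Y)
  qed
qed

section \<open>Heights on a tableau\<close>

definition box_sign :: "nat \<Rightarrow> filling \<Rightarrow> box \<Rightarrow> int" where
  "box_sign i T b = (if T b = i + 1 then 1 else if T b = i then - 1 else 0)"

text \<open>
  Summing over sets rather than over words makes the heights independent of lists, so that all
  later comparisons of heights are comparisons of sets of boxes.
\<close>

definition height :: "nat \<Rightarrow> weight \<Rightarrow> nat \<Rightarrow> filling \<Rightarrow> box \<Rightarrow> int" where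
  "height n lam i T q = sum (box_sign i T) (tail_of n lam q)"

definition total_height :: "nat \<Rightarrow> weight \<Rightarrow> nat \<Rightarrow> filling \<Rightarrow> int" where
  "total_height n lam i T = sum (box_sign i T) (young n lam)"

definition top_height :: "nat \<Rightarrow> weight \<Rightarrow> nat \<Rightarrow> filling \<Rightarrow> int" where
  "top_height n lam i T = Max (range (height n lam i T))"

definition next_box :: "box \<Rightarrow> box" where
  "next_box b = (fst b + 1, snd b)"

lemma sum_box_sign:
  "finite S \<Longrightarrow> sum (box_sign i T) S = int (card {b \<in> S. T b = i + 1}) - int (card {b \<in> S. T b = i})"
proof -
  assume "finite S"
  moreover have "box_sign i T b = (if T b = i + 1 then 1 else 0) - (if T b = i then 1 else 0)" for b
    by (simp add: box_sign_def)
  ultimately show ?thesis by (simp add: sum_subtractf sum.If_cases Int_def)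
qed

lemma flip_eq_iff:
  assumes "T \<in> fillings n lam" "i \<in> {1..n}" "b \<in> young n lam"
  shows "flip n lam T b = n + 1 - i \<longleftrightarrow> T b = i + 1"
    and "flip n lam T b = n + 1 - i + 1 \<longleftrightarrow> T b = i"
proof -
  have "T b \<in> {1..n + 1}" using assms by (simp add: fillings_def)
  then show "flip n lam T b = n + 1 - i \<longleftrightarrow> T b = i + 1"
    and "flip n lam T b = n + 1 - i + 1 \<longleftrightarrow> T b = i"
    using assms by (auto simp: flip_def)
qed

text \<open>
  The sign word of the flipped tableau for the index \<open>n + 1 - i\<close>, read off from the reverse tableau.
\<close>

definition reverse_signs :: "nat \<Rightarrow> filling \<Rightarrow> box list \<Rightarrow> (sign \<times> box) list" where
  "reverse_signs i T bs =
    concat (map (\<lambda>b. if T b = i + 1 then [(Plus, b)] else if T b = i then [(Minus, b)] else []) bs)"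

lemma signs_flip:
  assumes "T \<in> fillings n lam" "i \<in> {1..n}" "set bs \<subseteq> young n lam"
  shows "signs (n + 1 - i) (flip n lam T) bs = reverse_signs i T bs"
  using assms(3) flip_eq_iff[OF assms(1,2)] unfolding signs_def reverse_signs_def
  by (intro arg_cong[of _ _ concat] map_cong) auto

lemma reverse_signs_simps [simp]:
  "reverse_signs i T [] = []"
  "reverse_signs i T (b # bs) =
    (if T b = i + 1 then [(Plus, b)] else if T b = i then [(Minus, b)] else []) @ reverse_signs i T bs"
  "reverse_signs i T (as @ bs) = reverse_signs i T as @ reverse_signs i T bs"
  by (simp_all add: reverse_signs_def)

lemma reverse_signs_eq_Cons_split:
  assumes "reverse_signs i T bs = xs @ (s, b) # ys"
  shows "\<exists>as cs. bs = as @ b # cs \<and> reverse_signs i T as = xs \<and> reverse_signs i T cs = ys \<and>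
    T b = (if s = Plus then i + 1 else i)"
  using assms
proof (induction bs arbitrary: xs)
  case Nil
  then show ?case by simp
next
  case (Cons a bs)
  let ?h = "if T a = i + 1 then [(Plus, a)] else if T a = i then [(Minus, a)] else []"
  have eq: "?h @ reverse_signs i T bs = xs @ (s, b) # ys" using Cons.prems by simp
  show ?case
  proof (cases "xs = [] \<and> ?h \<noteq> []")
    case True
    then show ?thesis using eq by (intro exI[of _ "[]"] exI[of _ bs]) (auto split: if_splits)
  next
    case False
    then obtain xs' where xs: "xs = ?h @ xs'" and rest: "reverse_signs i T bs = xs' @ (s, b) # ys"
      using eq by (cases xs) (auto split: if_splits)
    obtain as cs where "bs = as @ b # cs" "reverse_signs i T as = xs'" "reverse_signs i T cs = ys"
      "T b = (if s = Plus then i + 1 else i)"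
      using Cons.IH[OF rest] by blast
    then show ?thesis using xs by (intro exI[of _ "a # as"] exI[of _ cs]) auto
  qed
qed

lemma word_height_reverse_signs:
  "distinct bs \<Longrightarrow> word_height (reverse_signs i T bs) = sum (box_sign i T) (set bs)"
  by (induction bs) (auto simp: box_sign_def)

lemma finite_range_height:
  assumes "lam \<in> dominant_weights n"
  shows "finite (range (height n lam i T))"
proof (rule finite_subset)
  show "range (height n lam i T) \<subseteq> sum (box_sign i T) ` Pow (young n lam)"
    by (auto simp: height_def tail_of_def)
qed (use finite_young[OF assms] in simp)

lemma top_height_eqI:
  assumes "lam \<in> dominant_weights n" "\<And>q. height n lam i T q \<le> N" "height n lam i T q = N"
  shows "top_height n lam i T = N"
  unfolding top_height_def using assms by (intro Max_eqI finite_range_height) auto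

lemma height_le_top: "lam \<in> dominant_weights n \<Longrightarrow> height n lam i T q \<le> top_height n lam i T"
  unfolding top_height_def using finite_range_height by (intro Max_ge) auto

lemma height_origin: "height n lam i T (0, 0) = 0"
proof -
  have "tail_of n lam (0, 0) = {}" by (auto simp: tail_of_def later_def young_def diagram_def)
  then show ?thesis by (simp add: height_def)
qed

text \<open>
  Translates \<open>cancel_by_heights\<close> from suffixes of the sign word to pairs: every pair names a suffix
  of the reading (\<open>filter_split_tail\<close>), and later pairs name shorter suffixes.
\<close>

lemma signature_by_heights:
  assumes lam: "lam \<in> dominant_weights n" and T: "T \<in> fillings n lam" and i: "i \<in> {1..n}"
  shows "\<exists>us vs. signature n lam (n + 1 - i) (flip n lam T) =
      map (Pair Minus) us @ map (Pair Plus) vs \<and>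
    int (length vs) = top_height n lam i T \<and>
    int (length us) = top_height n lam i T - total_height n lam i T \<and>
    (vs \<noteq> [] \<longrightarrow> hd vs \<in> young n lam \<and> T (hd vs) = i + 1 \<and>
      height n lam i T (hd vs) = top_height n lam i T \<and>
      (\<forall>q. later (hd vs) q \<longrightarrow> height n lam i T q < top_height n lam i T)) \<and>
    (us \<noteq> [] \<longrightarrow> last us \<in> young n lam \<and> T (last us) = i \<and>
      height n lam i T (next_box (last us)) = top_height n lam i T \<and>
      (\<forall>q. \<not> later (last us) q \<longrightarrow> height n lam i T q < top_height n lam i T))"
proof -
  define R where "R = reading n lam"
  define xs where "xs = reverse_signs i T R"
  note set_R = set_reading[OF lam, folded R_def]
  note sorted = sorted_reading[of n lam, folded R_def]
  note dist = distinct_if_sorted[OF sorted]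
  have sig: "signature n lam (n + 1 - i) (flip n lam T) = cancel xs"
    using signs_flip[OF T i] set_R unfolding signature_def xs_def R_def by simp
  have tail: "word_height (reverse_signs i T bs) = height n lam i T q"
    if "R = as @ bs" "set bs = tail_of n lam q" for as bs q
    using that dist by (simp add: word_height_reverse_signs height_def)
  have "\<exists>as bs. R = as @ bs \<and> set bs = tail_of n lam q" for q
    using filter_split_tail[OF sorted, of q] set_R
    by (intro exI[of _ "filter (\<lambda>b. later b q) R"] exI[of _ "filter (\<lambda>b. \<not> later b q) R"])
      (simp add: tail_of_def)
  then have suffix: "\<exists>as zs. xs = as @ zs \<and> word_height zs = height n lam i T q" for q
    using tail unfolding xs_def by (metis reverse_signs_simps(3))
  obtain us vs where heights: "signature_heights xs us vs"
    using cancel_by_heights[of xs] by blast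
  note heights = heights[unfolded signature_heights_def]
  have eq: "cancel xs = map (Pair Minus) us @ map (Pair Plus) vs"
    and total: "word_height xs = int (length vs) - int (length us)"
    and bound: "\<And>as zs. xs = as @ zs \<Longrightarrow> word_height zs \<le> int (length vs)"
    using heights by simp_all
  have le: "height n lam i T q \<le> int (length vs)" for q
    using suffix[of q] bound by metis
  have plus': "hd vs \<in> young n lam \<and> T (hd vs) = i + 1 \<and>
      height n lam i T (hd vs) = int (length vs) \<and>
      (\<forall>q. later (hd vs) q \<longrightarrow> height n lam i T q < int (length vs))" if ne: "vs \<noteq> []"
  proof -
    obtain as bs where split: "xs = as @ (Plus, hd vs) # bs"
      and h: "word_height bs = int (length vs) - 1"
      and short: "\<And>cs zs. bs = cs @ zs \<Longrightarrow> word_height zs < int (length vs)"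
      using heights ne by blast
    obtain As Bs where AB: "R = As @ hd vs # Bs" "reverse_signs i T Bs = bs" "T (hd vs) = i + 1"
      using reverse_signs_eq_Cons_split[OF split[unfolded xs_def]] by auto
    obtain r c where rc: "hd vs = (r, c)" by (cases "hd vs")
    note tails = reading_split[OF lam AB(1)[unfolded R_def rc]]
    have "word_height (reverse_signs i T (hd vs # Bs)) = height n lam i T (hd vs)"
      using tail[OF AB(1)] tails rc by simp
    then have "height n lam i T (hd vs) = int (length vs)" using h AB by simp
    moreover have "height n lam i T q < int (length vs)" if "later (hd vs) q" for q
    proof -
      have Bs: "sorted_wrt later Bs" using sorted AB(1) by (simp add: sorted_wrt_append)
      note sp = filter_split_tail[OF Bs, of q]
      have "set (filter (\<lambda>b. \<not> later b q) Bs) = tail_of n lam q"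
      proof -
        have "\<not> later b (r + 1, c)" if "\<not> later b q" for b
          using that \<open>later (hd vs) q\<close> unfolding rc later_def by force
        then show ?thesis using tails(1) by (auto simp: tail_of_def)
      qed
      then have "word_height (reverse_signs i T (filter (\<lambda>b. \<not> later b q) Bs)) = height n lam i T q"
        using tail[of "As @ hd vs # filter (\<lambda>b. later b q) Bs"] sp AB(1)
        by (metis append.assoc append_Cons)
      moreover have "bs = reverse_signs i T (filter (\<lambda>b. later b q) Bs) @
          reverse_signs i T (filter (\<lambda>b. \<not> later b q) Bs)"
        using sp AB(2) by (metis reverse_signs_simps(3))
      ultimately show ?thesis using short by metis
    qed
    moreover have "hd vs \<in> young n lam" using set_R AB(1) by auto
    ultimately show ?thesis using AB(3) by blast
  qed
  have minus': "last us \<in> young n lam \<and> T (last us) = i \<and>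
      height n lam i T (next_box (last us)) = int (length vs) \<and>
      (\<forall>q. \<not> later (last us) q \<longrightarrow> height n lam i T q < int (length vs))" if ne: "us \<noteq> []"
  proof -
    obtain as bs where split: "xs = as @ (Minus, last us) # bs"
      and h: "word_height bs = int (length vs)"
      and long: "\<And>cs ds. as = cs @ ds \<Longrightarrow>
        word_height (ds @ (Minus, last us) # bs) < int (length vs)"
      using heights ne by blast
    obtain As Bs where AB: "R = As @ last us # Bs" "reverse_signs i T As = as"
      "reverse_signs i T Bs = bs" "T (last us) = i"
      using reverse_signs_eq_Cons_split[OF split[unfolded xs_def]] by auto
    obtain r c where rc: "last us = (r, c)" by (cases "last us")
    note tails = reading_split[OF lam AB(1)[unfolded R_def rc]]
    have "height n lam i T (next_box (last us)) = int (length vs)"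
      using tail[of "As @ [last us]" Bs] AB tails(1) h rc by (simp add: next_box_def)
    moreover have "height n lam i T q < int (length vs)" if nl: "\<not> later (last us) q" for q
    proof -
      have As: "sorted_wrt later As" using sorted AB(1) by (simp add: sorted_wrt_append)
      note sp = filter_split_tail[OF As, of q]
      let ?zs = "filter (\<lambda>b. \<not> later b q) As @ last us # Bs"
      have "b \<notin> set (last us # Bs) \<or> \<not> later b q" for b
        using tails(2) nl rc by (auto simp: tail_of_def later_def)
      then have "set ?zs = tail_of n lam q"
        using set_R AB(1) by (force simp: tail_of_def)
      then have "word_height (reverse_signs i T ?zs) = height n lam i T q"
        using tail[of "filter (\<lambda>b. later b q) As" ?zs] sp AB(1) by (metis append.assoc)
      moreover have "as = reverse_signs i T (filter (\<lambda>b. later b q) As) @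
          reverse_signs i T (filter (\<lambda>b. \<not> later b q) As)"
        using sp AB(2) by (metis reverse_signs_simps(3))
      ultimately show ?thesis using long AB by force
    qed
    moreover have "last us \<in> young n lam" using set_R AB(1) by auto
    ultimately show ?thesis using AB by blast
  qed
  have "\<exists>q. height n lam i T q = int (length vs)"
    using plus' height_origin[of n lam i T] by (cases "vs = []") (metis list.size(3) of_nat_0, blast)
  then have top: "top_height n lam i T = int (length vs)"
    using top_height_eqI[OF lam] le by blast
  have "total_height n lam i T = word_height xs"
    using word_height_reverse_signs[OF dist] set_R by (simp add: xs_def total_height_def)
  then show ?thesis
    using sig eq total plus' minus' top by (intro exI[of _ us] exI[of _ vs]) simp
qed

section \<open>Reverse tableaux\<close>

lemma young_iff:
  assumes "lam \<in> dominant_weights n"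
  shows "(r, c) \<in> young n lam \<longleftrightarrow> 1 \<le> r \<and> 1 \<le> c \<and> int c \<le> part n lam r"
proof -
  have "part n lam r = 0" if "n < r" using that by (simp add: part_def)
  then show ?thesis by (cases "n < r") (auto simp: young_def diagram_def)
qed

lemma young_shrink:
  assumes "lam \<in> dominant_weights n" "(r', c') \<in> young n lam" "1 \<le> r" "r \<le> r'" "1 \<le> c" "c \<le> c'"
  shows "(r, c) \<in> young n lam"
  using assms part_antimono[OF assms(1), of r r'] by (simp add: young_iff)

text \<open>
  Because fillings vanish outside the diagram and subtraction of naturals is truncated, the
  tableau conditions hold for all pairs of positive indices without reference to the diagram.
\<close>

lemma reverse_ssyt_iff:
  assumes "lam \<in> dominant_weights n"
  shows "T \<in> reverse_ssyt n lam \<longleftrightarrow> T \<in> fillings n lam \<and>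
    (\<forall>r\<ge>1. \<forall>c\<ge>1. T (r, c + 1) \<le> T (r, c) \<and> T (r + 1, c) \<le> T (r, c) - 1)"
    (is "_ \<longleftrightarrow> ?R")
proof
  assume T: "T \<in> reverse_ssyt n lam"
  have out: "T b = 0" if "b \<notin> young n lam" for b
    using T that unfolding reverse_ssyt_def fillings_def by blast
  have "T (r, c + 1) \<le> T (r, c) \<and> T (r + 1, c) \<le> T (r, c) - 1" if "1 \<le> r" "1 \<le> c" for r c
  proof
    show "T (r, c + 1) \<le> T (r, c)"
      using T out[of "(r, c + 1)"] young_shrink[OF assms, of r "c + 1" r c] that
      by (cases "(r, c + 1) \<in> young n lam") (auto simp: reverse_ssyt_def)
    show "T (r + 1, c) \<le> T (r, c) - 1"
      using T out[of "(r + 1, c)"] young_shrink[OF assms, of "r + 1" c r c] that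
      by (cases "(r + 1, c) \<in> young n lam") (fastforce simp: reverse_ssyt_def)+
  qed
  then show ?R using T by (simp add: reverse_ssyt_def)
next
  assume R: ?R
  have pos: "1 \<le> r \<and> 1 \<le> c \<and> 1 \<le> T (r, c)" if "(r, c) \<in> young n lam" for r c
    using R that young_iff[OF assms] by (auto simp: fillings_def)
  show "T \<in> reverse_ssyt n lam"
    unfolding reverse_ssyt_def
  proof (intro CollectI conjI allI impI)
    show "T (r, c + 1) \<le> T (r, c)" if "(r, c) \<in> young n lam \<and> (r, c + 1) \<in> young n lam" for r c
      using R pos that by blast
    show "T (r + 1, c) < T (r, c)" if "(r, c) \<in> young n lam \<and> (r + 1, c) \<in> young n lam" for r c
    proof -
      have "T (r + 1, c) \<le> T (r, c) - 1" using R pos that by blast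
      then show ?thesis using pos[of r c] that by linarith
    qed
  qed (use R in blast)
qed

context
  fixes n :: nat and lam :: weight
  assumes lam: "lam \<in> dominant_weights n"
begin

lemma outside: "T \<in> reverse_ssyt n lam \<Longrightarrow> b \<notin> young n lam \<Longrightarrow> T b = 0"
  unfolding reverse_ssyt_def fillings_def by blast

lemma row_step: "T \<in> reverse_ssyt n lam \<Longrightarrow> 1 \<le> r \<Longrightarrow> 1 \<le> c \<Longrightarrow> T (r, c + 1) \<le> T (r, c)"
  using reverse_ssyt_iff[OF lam] by blast

lemma column_drop: "T \<in> reverse_ssyt n lam \<Longrightarrow> 1 \<le> r \<Longrightarrow> 1 \<le> c \<Longrightarrow> T (r + d, c) \<le> T (r, c) - d"
proof (induction d)
  case (Suc d)
  have "T (r + d + 1, c) \<le> T (r + d, c) - 1" using Suc.prems reverse_ssyt_iff[OF lam] by auto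
  then show ?case using Suc by simp
qed simp

text \<open>
  Columns decrease strictly from at most \<open>n + 1\<close>, so row \<open>r\<close> contains only entries up to
  \<open>n + 2 - r\<close>. This is why \<open>x\<^sub>j\<^sup>(\<^sup>i\<^sup>)\<close> vanishes for \<open>i + j > n + 1\<close>.
\<close>

lemma entry_plus_row_le:
  assumes "T \<in> reverse_ssyt n lam" "1 \<le> r" "1 \<le> c" "1 \<le> T (r, c)"
  shows "T (r, c) + r \<le> n + 2"
proof -
  have "T (1, c) \<le> n + 1"
    using assms(1)
    by (cases "(1, c) \<in> young n lam") (auto simp: reverse_ssyt_def fillings_def)
  moreover have "T (1 + (r - 1), c) \<le> T (1, c) - (r - 1)"
    by (rule column_drop[OF assms(1) _ assms(3)]) simp
  moreover have "1 + (r - 1) = r" using assms(2) by simp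
  ultimately have "T (r, c) \<le> n + 1 - (r - 1)" by simp
  then show ?thesis using assms by arith
qed

lemma row_mono:
  assumes "T \<in> reverse_ssyt n lam" "1 \<le> r" "1 \<le> c" "c \<le> c'"
  shows "T (r, c') \<le> T (r, c)"
  using assms(4)
proof (induction rule: dec_induct)
  case (step m)
  then show ?case using row_step[OF assms(1,2), of m] assms(3) by simp
qed simp

lemma tail_insert: "(r, c) \<in> young n lam \<Longrightarrow>
    tail_of n lam (r, c) = insert (r, c) (tail_of n lam (r + 1, c))"
  by (auto simp: tail_of_def later_def)

lemma tail_skip: "(r, c) \<notin> young n lam \<Longrightarrow> tail_of n lam (r, c) = tail_of n lam (r + 1, c)"
proof -
  assume out: "(r, c) \<notin> young n lam"
  have "later b (r, c) \<longleftrightarrow> later b (r + 1, c)" if "b \<in> young n lam" for b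
  proof -
    have "b \<noteq> (r, c)" using that out by blast
    then show ?thesis by (cases b) (auto simp: later_def)
  qed
  then show ?thesis unfolding tail_of_def by blast
qed

lemma finite_tail: "finite (tail_of n lam q)"
  using finite_young[OF lam] by (simp add: tail_of_def)

lemma height_step:
  assumes "T \<in> reverse_ssyt n lam" "1 \<le> i"
  shows "height n lam i T (r, c) = box_sign i T (r, c) + height n lam i T (r + 1, c)"
proof (cases "(r, c) \<in> young n lam")
  case True
  have "(r, c) \<notin> tail_of n lam (r + 1, c)" by (simp add: tail_of_def later_def)
  then show ?thesis using True by (simp add: height_def tail_insert finite_tail)
next
  case False
  then show ?thesis using assms outside[OF assms(1) False] tail_skip[OF False]
    by (simp add: height_def box_sign_def)
qed

text \<open>
  Below the bottom of column \<open>c + 1\<close> the reading continues at the top of column \<open>c\<close>; row \<open>0\<close> serves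
  as a position in front of every box of the column.
\<close>

lemma height_column_end:
  assumes "n < r"
  shows "height n lam i T (r, c + 1) = height n lam i T (0, c)"
proof -
  have "tail_of n lam (r, c + 1) = tail_of n lam (0, c)"
    using assms by (fastforce simp: tail_of_def later_def young_def diagram_def)
  then show ?thesis by (simp add: height_def)
qed

lemma height_skip:
  assumes "T \<in> reverse_ssyt n lam" "1 \<le> i" "r \<le> r'"
    and zero: "\<And>k. r \<le> k \<Longrightarrow> k < r' \<Longrightarrow> box_sign i T (k, c) = 0"
  shows "height n lam i T (r, c) = height n lam i T (r', c)"
  using assms(3) zero
proof (induction rule: dec_induct)
  case (step m)
  then show ?case using height_step[OF assms(1,2), of m c] by simp
qed simp

lemma box_sign_below:
  assumes "T \<in> reverse_ssyt n lam" "1 \<le> i" "1 \<le> r" "1 \<le> c" "r < k" "T (r, c) \<le> i"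
  shows "box_sign i T (k, c) = 0"
  using column_drop[OF assms(1,3,4), of "k - r"] assms by (auto simp: box_sign_def)

lemma box_sign_above:
  assumes "T \<in> reverse_ssyt n lam" "1 \<le> i" "1 \<le> c" "k < r" "i + 1 \<le> T (r, c)"
  shows "box_sign i T (k, c) = 0"
proof (cases "k = 0")
  case True
  then show ?thesis using outside[OF assms(1), of "(k, c)"] assms(2) young_iff[OF lam]
    by (simp add: box_sign_def)
next
  case False
  then show ?thesis
    using column_drop[OF assms(1), of k c "r - k"] assms by (auto simp: box_sign_def)
qed

lemma update_in_fillings:
  assumes "T \<in> fillings n lam" "b \<in> young n lam" "v \<in> {1..n + 1}"
  shows "T(b := v) \<in> fillings n lam"
  using assms by (auto simp: fillings_def)

text \<open>
  Between two horizontally adjacent boxes the reading meets nonzero signs only at the right box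
  and just below it: above an entry \<open>i + 1\<close> a column has entries \<open>> i + 1\<close>, and two rows below an
  entry \<open>\<le> i + 1\<close> it has entries \<open>< i\<close>.
\<close>

lemma adjacent_columns:
  assumes T: "T \<in> reverse_ssyt n lam" and i: "1 \<le> i" and rc: "1 \<le> r" "1 \<le> c"
    and left: "T (r, c) = i + 1" and right: "T (r, c + 1) = i + 1 \<or> T (r, c + 1) = i"
  shows "height n lam i T (r, c) =
    height n lam i T (r, c + 1) - box_sign i T (r, c + 1) - box_sign i T (r + 1, c + 1)"
proof -
  have "height n lam i T (r, c) = height n lam i T (0, c)"
    using box_sign_above[OF T i rc(2)] left by (intro height_skip[OF T i, symmetric]) auto
  also have "\<dots> = height n lam i T (r + 2 + n, c + 1)"
    by (intro height_column_end[symmetric]) simp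
  also have "\<dots> = height n lam i T (r + 2, c + 1)"
  proof (rule height_skip[OF T i, symmetric])
    show "box_sign i T (k, c + 1) = 0" if "r + 2 \<le> k" for k
      using column_drop[OF T rc(1), of "c + 1" "k - r"] right that i by (auto simp: box_sign_def)
  qed simp
  finally show ?thesis
    using height_step[OF T i, of r "c + 1"] height_step[OF T i, of "r + 1" "c + 1"] by simp
qed

text \<open>
  If the box opens the shortest final segment of maximal height, no entry \<open>i\<close> lies below it, since
  skipping both boxes would leave a shorter segment of the same height. Then the right neighbour
  cannot be \<open>i + 1\<close>, since starting there would give a larger height. So the entry can be
  decreased.
\<close>

lemma decrease_entry:
  assumes T: "T \<in> reverse_ssyt n lam" and i: "i \<in> {1..n}" and b: "(r, c) \<in> young n lam"
    and Tb: "T (r, c) = i + 1"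
    and max: "\<And>q. height n lam i T q \<le> height n lam i T (r, c)"
    and short: "\<And>q. later (r, c) q \<Longrightarrow> height n lam i T q < height n lam i T (r, c)"
  shows "T((r, c) := i) \<in> reverse_ssyt n lam"
proof -
  have i1: "1 \<le> i" using i by simp
  have rc: "1 \<le> r" "1 \<le> c" using b young_iff[OF lam] by auto
  have step: "height n lam i T (r, c) = 1 + height n lam i T (r + 1, c)"
    using height_step[OF T i1, of r c] Tb by (simp add: box_sign_def)
  have below: "T (r + 1, c) < i"
  proof -
    have "T (r + 1, c) \<noteq> i"
    proof
      assume "T (r + 1, c) = i"
      then have "height n lam i T (r + 1, c) = height n lam i T (r + 2, c) - 1"
        using height_step[OF T i1, of "r + 1" c] by (simp add: box_sign_def)
      then show False using step short[of "(r + 2, c)"] by (simp add: later_def)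
    qed
    then show ?thesis using column_drop[OF T rc, of 1] Tb by simp
  qed
  have right: "T (r, c + 1) \<le> i"
  proof (rule ccontr)
    assume "\<not> ?thesis"
    then have R: "T (r, c + 1) = i + 1" using row_step[OF T rc] Tb by simp
    have "box_sign i T (r + 1, c + 1) = 0"
      using row_step[OF T, of "r + 1" c] rc below i1 by (auto simp: box_sign_def)
    moreover have "height n lam i T (r, c) =
        height n lam i T (r, c + 1) - 1 - box_sign i T (r + 1, c + 1)"
      using adjacent_columns[OF T i1 rc Tb] R by (simp add: box_sign_def)
    ultimately show False using max[of "(r, c + 1)"] by simp
  qed
  have "T((r, c) := i) \<in> fillings n lam"
    using T b i by (intro update_in_fillings) (auto simp: reverse_ssyt_def)
  moreover have "(T((r, c) := i)) (r', c' + 1) \<le> (T((r, c) := i)) (r', c')"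
    if "1 \<le> r'" "1 \<le> c'" for r' c'
    using row_step[OF T that] right Tb by auto
  moreover have "(T((r, c) := i)) (r' + 1, c') \<le> (T((r, c) := i)) (r', c') - 1"
    if "1 \<le> r'" "1 \<le> c'" for r' c'
    using column_drop[OF T that, of 1] below Tb by auto
  ultimately show ?thesis by (simp add: reverse_ssyt_iff[OF lam] del: fun_upd_apply)
qed

text \<open>
  The mirror image of the previous argument: an entry \<open>i + 1\<close> directly above would yield a longer
  segment of maximal height, and an entry \<open>i\<close> directly to the left a segment of larger height.
\<close>

lemma increase_entry:
  assumes T: "T \<in> reverse_ssyt n lam" and i: "i \<in> {1..n}" and b: "(r, c) \<in> young n lam"
    and Tb: "T (r, c) = i"
    and max: "\<And>q. height n lam i T q \<le> height n lam i T (r + 1, c)"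
    and long: "\<And>q. \<not> later (r, c) q \<Longrightarrow> height n lam i T q < height n lam i T (r + 1, c)"
  shows "T((r, c) := i + 1) \<in> reverse_ssyt n lam"
proof -
  have i1: "1 \<le> i" using i by simp
  have rc: "1 \<le> r" "1 \<le> c" using b young_iff[OF lam] by auto
  have step: "height n lam i T (r, c) = height n lam i T (r + 1, c) - 1"
    using height_step[OF T i1, of r c] Tb by (simp add: box_sign_def)
  have above: "i + 1 < T (r - 1, c)" if "r \<noteq> 1"
  proof -
    have "T (r - 1, c) \<noteq> i + 1"
    proof
      assume "T (r - 1, c) = i + 1"
      then have "height n lam i T (r - 1, c) = height n lam i T (r, c) + 1"
        using height_step[OF T i1, of "r - 1" c] rc by (simp add: box_sign_def)
      moreover have "\<not> later (r, c) (r - 1, c)" using rc by (simp add: later_def)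
      ultimately show False using step long[of "(r - 1, c)"] by simp
    qed
    moreover have "T (r, c) \<le> T (r - 1, c) - 1"
      using column_drop[OF T, of "r - 1" c 1] that rc by simp
    ultimately show ?thesis using Tb i1 by simp
  qed
  have left: "i + 1 \<le> T (r, c - 1)" if "c \<noteq> 1"
  proof (rule ccontr)
    have c1: "1 \<le> c - 1" using that rc by simp
    assume "\<not> ?thesis"
    then have L: "T (r, c - 1) = i" using row_step[OF T rc(1) c1] Tb rc by simp
    have "height n lam i T (r + 1, c) = height n lam i T (r + 1 + n, c)"
      using box_sign_below[OF T i1 rc] Tb by (intro height_skip[OF T i1]) auto
    also have "\<dots> = height n lam i T (0, c - 1)"
      using height_column_end[of "r + 1 + n" i T "c - 1"] rc by simp
    also have "\<dots> = height n lam i T (r - 1, c - 1)"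
    proof (rule height_skip[OF T i1])
      show "box_sign i T (k, c - 1) = 0" if "k < r - 1" for k
      proof (cases "k = 0")
        case True
        then show ?thesis using outside[OF T, of "(k, c - 1)"] i1 young_iff[OF lam]
          by (simp add: box_sign_def)
      next
        case False
        then show ?thesis using column_drop[OF T _ c1, of k "r - k"] L that i1
          by (auto simp: box_sign_def)
      qed
    qed simp
    also have "\<dots> = box_sign i T (r - 1, c - 1) + height n lam i T (r, c - 1)"
      using height_step[OF T i1, of "r - 1" "c - 1"] rc by simp
    also have "height n lam i T (r, c - 1) = height n lam i T (r + 1, c - 1) - 1"
      using height_step[OF T i1, of r "c - 1"] L by (simp add: box_sign_def)
    finally have h: "height n lam i T (r + 1, c) =
      box_sign i T (r - 1, c - 1) + height n lam i T (r + 1, c - 1) - 1" by simp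
    have "box_sign i T (r - 1, c - 1) \<le> 0"
    proof (cases "r = 1")
      case True
      then show ?thesis using outside[OF T, of "(r - 1, c - 1)"] i1 young_iff[OF lam]
        by (simp add: box_sign_def)
    next
      case False
      have "T (r - 1, c) \<le> T (r - 1, c - 1)" using row_mono[OF T _ c1, of "r - 1" c] False rc by simp
      then show ?thesis using above[OF False] by (simp add: box_sign_def)
    qed
    then show False using h max[of "(r + 1, c - 1)"] by simp
  qed
  have "T((r, c) := i + 1) \<in> fillings n lam"
    using T b i by (intro update_in_fillings) (auto simp: reverse_ssyt_def)
  moreover have "(T((r, c) := i + 1)) (r', c' + 1) \<le> (T((r, c) := i + 1)) (r', c')"
    if "1 \<le> r'" "1 \<le> c'" for r' c'
    using row_step[OF T that] left Tb that by auto
  moreover have "(T((r, c) := i + 1)) (r' + 1, c') \<le> (T((r, c) := i + 1)) (r', c') - 1"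
    if "1 \<le> r'" "1 \<le> c'" for r' c'
    using column_drop[OF T that, of 1] above Tb that by auto
  ultimately show ?thesis by (simp add: reverse_ssyt_iff[OF lam] del: fun_upd_apply)
qed

end

\<comment> \<open>Boxes are quantified over as a whole; splitting them into coordinates hides the assumptions.\<close>
declare split_paired_All [simp del] split_paired_Ex [simp del]

section \<open>The crystal of reverse tableaux\<close>

text \<open>
  \<open>f_step\<close> and \<open>e_step\<close> are the operators \<open>f\<^sub>i\<close> and \<open>e\<^sub>i\<close> as relations, determined by heights only: the
  box \<open>b\<close> that \<open>f\<^sub>i\<close> changes immediately precedes the longest final segment of maximal height, the one
  that \<open>e\<^sub>i\<close> changes opens the shortest.
\<close>

definition f_step :: "nat \<Rightarrow> weight \<Rightarrow> nat \<Rightarrow> filling \<Rightarrow> box \<Rightarrow> filling \<Rightarrow> bool" where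
  "f_step n lam i T b T' \<longleftrightarrow> b \<in> young n lam \<and> T b = i \<and> T' = T(b := i + 1) \<and>
    (\<forall>q. height n lam i T q \<le> height n lam i T (next_box b)) \<and>
    (\<forall>q. \<not> later b q \<longrightarrow> height n lam i T q < height n lam i T (next_box b))"

definition e_step :: "nat \<Rightarrow> weight \<Rightarrow> nat \<Rightarrow> filling \<Rightarrow> box \<Rightarrow> filling \<Rightarrow> bool" where
  "e_step n lam i T b T' \<longleftrightarrow> b \<in> young n lam \<and> T b = i + 1 \<and> T' = T(b := i) \<and>
    (\<forall>q. height n lam i T q \<le> height n lam i T b) \<and>
    (\<forall>q. later b q \<longrightarrow> height n lam i T q < height n lam i T b)"

lemma alpha_apply:
  assumes "i \<in> {1..n}"
  shows "alpha n i k =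
    (if k \<in> {1..n} then (if k = i then 2 else if k = i + 1 \<or> i = k + 1 then - 1 else 0) else 0)"
  using assms by (auto simp: alpha_def epsilon_def omega_def)

context
  fixes n :: nat and lam :: weight
  assumes lam: "lam \<in> dominant_weights n"
begin

lemma height_update:
  assumes "b \<in> young n lam"
  shows "height n lam i (T(b := v)) q = height n lam i T q +
    (if later b q then 0 else box_sign i (T(b := v)) b - box_sign i T b)"
proof (cases "later b q")
  case True
  then have "b \<notin> tail_of n lam q" by (simp add: tail_of_def)
  then show ?thesis using True unfolding height_def
    by (auto simp: box_sign_def intro!: sum.cong)
next
  case False
  then have b: "b \<in> tail_of n lam q" using assms by (simp add: tail_of_def)
  have "sum (box_sign i (T(b := v))) (tail_of n lam q - {b}) =
      sum (box_sign i T) (tail_of n lam q - {b})"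
    by (intro sum.cong) (auto simp: box_sign_def)
  then show ?thesis
    using False sum.remove[OF finite_tail[OF lam] b, of "box_sign i T"]
      sum.remove[OF finite_tail[OF lam] b, of "box_sign i (T(b := v))"]
    by (simp add: height_def)
qed

lemma total_height_eq_height: "\<exists>C. (\<forall>b\<in>young n lam. \<not> later b (0, C)) \<and>
    total_height n lam i T = height n lam i T (0, C)"
proof -
  \<comment> \<open>Any column to the right of the whole diagram will do.\<close>
  define C where "C = Suc (Max (snd ` young n lam))"
  have "snd b < C" if "b \<in> young n lam" for b
    using that finite_young[OF lam] by (simp add: C_def le_imp_less_Suc)
  then have before: "\<forall>b\<in>young n lam. \<not> later b (0, C)" by (fastforce simp: later_def)
  then have "tail_of n lam (0, C) = young n lam" by (auto simp: tail_of_def)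
  then show ?thesis using before by (auto simp: height_def total_height_def)
qed

lemma total_le_top: "total_height n lam i T \<le> top_height n lam i T"
proof -
  obtain C where "total_height n lam i T = height n lam i T (0, C)"
    using total_height_eq_height by blast
  then show ?thesis using height_le_top[OF lam, of i T "(0, C)"] by simp
qed

lemma total_height_update:
  assumes "b \<in> young n lam"
  shows "total_height n lam i (T(b := v)) =
    total_height n lam i T + box_sign i (T(b := v)) b - box_sign i T b"
proof -
  have "sum (box_sign i (T(b := v))) (young n lam - {b}) =
      sum (box_sign i T) (young n lam - {b})"
    by (intro sum.cong) (auto simp: box_sign_def)
  then show ?thesis
    using sum.remove[OF finite_young[OF lam] assms, of "box_sign i T"]
      sum.remove[OF finite_young[OF lam] assms, of "box_sign i (T(b := v))"]
    by (simp add: total_height_def)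
qed

lemma later_next: "later b (next_box b)"
  by (simp add: later_def next_box_def)

lemma height_next:
  assumes "T \<in> reverse_ssyt n lam" "1 \<le> i"
  shows "height n lam i T b = box_sign i T b + height n lam i T (next_box b)"
  using height_step[OF lam assms, of "fst b" "snd b"] by (simp add: next_box_def)

lemma f_step_in:
  assumes "T \<in> reverse_ssyt n lam" "i \<in> {1..n}" "f_step n lam i T b T'"
  shows "T' \<in> reverse_ssyt n lam"
  using assms increase_entry[OF lam assms(1,2), of "fst b" "snd b"]
  by (simp add: f_step_def next_box_def)

lemma e_step_in:
  assumes "T \<in> reverse_ssyt n lam" "i \<in> {1..n}" "e_step n lam i T b T'"
  shows "T' \<in> reverse_ssyt n lam"
  using assms decrease_entry[OF lam assms(1,2), of "fst b" "snd b"]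
  by (simp add: e_step_def)

text \<open>
  Turning \<open>i\<close> into \<open>i + 1\<close> at \<open>b\<close> adds 2 to the heights of exactly those final segments that contain
  \<open>b\<close>. If \<open>N\<close> is the old maximum, attained just after \<open>b\<close>, the segment opened by \<open>b\<close> gets height
  \<open>N + 1\<close>; the bound \<open>< N\<close> for the segments containing \<open>b\<close> becomes \<open>\<le> N + 1\<close>, and the bound
  \<open>\<le> N\<close> for the shorter ones becomes \<open>< N + 1\<close>.
\<close>

lemma f_step_iff_e_step:
  assumes T: "T \<in> reverse_ssyt n lam" and T': "T' \<in> reverse_ssyt n lam" and i: "1 \<le> i"
  shows "f_step n lam i T b T' \<longleftrightarrow> e_step n lam i T' b T"
proof (cases "b \<in> young n lam \<and> T b = i \<and> T' = T(b := i + 1)")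
  case True
  then have T_eq: "T = T'(b := i)" "T' b = i + 1" by auto
  have shift: "height n lam i T' q = height n lam i T q + (if later b q then 0 else 2)" for q
    using True height_update[of b i T "i + 1" q] by (simp add: box_sign_def)
  have "height n lam i T' b = height n lam i T (next_box b) + 1"
    using height_next[OF T' i, of b] shift[of "next_box b"] T_eq(2) later_next
    by (simp add: box_sign_def)
  then have "(\<forall>q. height n lam i T q \<le> height n lam i T (next_box b)) \<and>
      (\<forall>q. \<not> later b q \<longrightarrow> height n lam i T q < height n lam i T (next_box b)) \<longleftrightarrow>
      (\<forall>q. height n lam i T' q \<le> height n lam i T' b) \<and>
      (\<forall>q. later b q \<longrightarrow> height n lam i T' q < height n lam i T' b)"
    unfolding shift by (smt (verit))
  then show ?thesis using True T_eq unfolding f_step_def e_step_def by blast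
next
  case False
  have "\<not> e_step n lam i T' b T" using False unfolding e_step_def by auto
  then show ?thesis using False unfolding f_step_def by auto
qed

lemma f_step_top: "f_step n lam i T b T' \<Longrightarrow> top_height n lam i T = height n lam i T (next_box b)"
  by (rule top_height_eqI[OF lam]) (auto simp: f_step_def)

lemma e_step_top: "e_step n lam i T b T' \<Longrightarrow> top_height n lam i T = height n lam i T b"
  by (rule top_height_eqI[OF lam]) (auto simp: e_step_def)

lemma f_step_unique:
  assumes "f_step n lam i T b T'" "f_step n lam i T b2 T2"
  shows "b2 = b"
proof -
  have "\<not> later b b2" if "f_step n lam i T b T'" "f_step n lam i T b2 T2" for b T' b2 T2
  proof
    assume "later b b2"
    then have "\<not> later b2 (next_box b)" by (auto simp: later_def next_box_def)
    then show False using that f_step_top[OF that(1)] f_step_top[OF that(2)]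
      by (force simp: f_step_def)
  qed
  then show ?thesis using assms later_linear by blast
qed

lemma e_step_unique:
  assumes "e_step n lam i T b T'" "e_step n lam i T b2 T2"
  shows "b2 = b"
proof -
  have "\<not> later b b2" if "e_step n lam i T b T'" "e_step n lam i T b2 T2" for b T' b2 T2
    using that e_step_top[OF that(1)] e_step_top[OF that(2)] by (force simp: e_step_def)
  then show ?thesis using assms later_linear by blast
qed

lemma total_less_top:
  "f_step n lam i T b T' \<Longrightarrow> total_height n lam i T < top_height n lam i T"
  using total_height_eq_height[of i T] by (fastforce simp: f_step_top f_step_def)

lemma top_positive:
  assumes "e_step n lam i T b T'"
  shows "0 < top_height n lam i T"
proof -
  have "later b (0, 0)"
    using assms young_iff[OF lam, of "fst b" "snd b"] by (auto simp: e_step_def later_def)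
  then show ?thesis
    using assms e_step_top[OF assms] height_origin[of n lam i T] by (auto simp: e_step_def)
qed

lemma unflip_flip:
  assumes "T \<in> reverse_ssyt n lam"
  shows "unflip n lam (flip n lam T) = T"
  unfolding unflip_def
proof (rule the_inv_into_f_f)
  show "inj_on (flip n lam) (reverse_ssyt n lam)"
  proof (intro inj_onI ext)
    fix T T' b
    assume T: "T \<in> reverse_ssyt n lam" "T' \<in> reverse_ssyt n lam"
      and eq: "flip n lam T = flip n lam T'"
    show "T b = T' b"
    proof (cases "b \<in> young n lam")
      case True
      then have "T b \<in> {1..n + 1}" "T' b \<in> {1..n + 1}"
        using T unfolding reverse_ssyt_def fillings_def by blast+
      moreover have "n + 2 - T b = n + 2 - T' b"
        using True fun_cong[OF eq, of b] by (simp add: flip_def)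
      ultimately show ?thesis unfolding atLeastAtMost_iff by arith
    next
      case False
      then show ?thesis using outside[OF lam T(1) False] outside[OF lam T(2) False] by simp
    qed
  qed
qed (use assms in simp)

lemma fillings_if_reverse: "T \<in> reverse_ssyt n lam \<Longrightarrow> T \<in> fillings n lam"
  by (simp add: reverse_ssyt_def)

lemma reverse_crystal_simps:
  "elts (reverse_ssyt_crystal n lam) = reverse_ssyt n lam"
  "wt (reverse_ssyt_crystal n lam) = tableau_wt n lam"
  by (simp_all add: reverse_ssyt_crystal_def Let_def)

text \<open>
  The flip exchanges
  \<open>e\<close> with \<open>f\<close>, which is why the surviving \<open>+\<close> count for \<open>\<epsilon>\<^sub>i\<close> here.
\<close>

lemma reverse_crystal_operators:
  assumes T: "T \<in> reverse_ssyt n lam" and i: "i \<in> {1..n}"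
  shows "eps (reverse_ssyt_crystal n lam) i T = Fin (top_height n lam i T)"
    and "phi (reverse_ssyt_crystal n lam) i T =
      Fin (top_height n lam i T - total_height n lam i T)"
    and "ft (reverse_ssyt_crystal n lam) i T = Some T' \<longleftrightarrow> (\<exists>b. f_step n lam i T b T')"
    and "et (reverse_ssyt_crystal n lam) i T = Some T' \<longleftrightarrow> (\<exists>b. e_step n lam i T b T')"
    and "ft (reverse_ssyt_crystal n lam) i T = None \<longleftrightarrow> total_height n lam i T = top_height n lam i T"
    and "et (reverse_ssyt_crystal n lam) i T = None \<longleftrightarrow> top_height n lam i T = 0"
proof -
  let ?C = "reverse_ssyt_crystal n lam"
  let ?sig = "signature n lam (n + 1 - i) (flip n lam T)"
  let ?top = "top_height n lam i T"
  obtain us vs where sig: "?sig = map (Pair Minus) us @ map (Pair Plus) vs"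
    and vs: "int (length vs) = ?top"
    and us: "int (length us) = ?top - total_height n lam i T"
    and plus: "vs \<noteq> [] \<Longrightarrow> hd vs \<in> young n lam \<and> T (hd vs) = i + 1 \<and>
      height n lam i T (hd vs) = ?top \<and> (\<forall>q. later (hd vs) q \<longrightarrow> height n lam i T q < ?top)"
    and minus: "us \<noteq> [] \<Longrightarrow> last us \<in> young n lam \<and> T (last us) = i \<and>
      height n lam i T (next_box (last us)) = ?top \<and>
      (\<forall>q. \<not> later (last us) q \<longrightarrow> height n lam i T q < ?top)"
    using signature_by_heights[OF lam fillings_if_reverse[OF T] i] by blast
  have boxes: "boxes_of Plus ?sig = vs" "boxes_of Minus ?sig = us"
    unfolding sig boxes_of_def by (simp_all add: filter_map o_def)
  have "eps ?C i T = Fin (int (length (boxes_of Plus ?sig)))"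
    by (simp add: reverse_ssyt_crystal_def ssyt_crystal_def)
  then show "eps ?C i T = Fin ?top" unfolding boxes vs .
  have "phi ?C i T = Fin (int (length (boxes_of Minus ?sig)))"
    by (simp add: reverse_ssyt_crystal_def ssyt_crystal_def)
  then show "phi ?C i T = Fin (?top - total_height n lam i T)" unfolding boxes us .
  have flip_update: "(flip n lam T)(b := n + 2 - v) = flip n lam (T(b := v))"
    if "b \<in> young n lam" for b v
    using that by (auto simp: flip_def)
  have "ft ?C i T = (if boxes_of Minus ?sig = [] then None
      else Some (unflip n lam ((flip n lam T)(last (boxes_of Minus ?sig) := n + 1 - i))))"
    by (simp add: reverse_ssyt_crystal_def ssyt_crystal_def tableau_e_def Let_def)
  then have ft: "ft ?C i T = (if us = [] then None
      else Some (unflip n lam ((flip n lam T)(last us := n + 1 - i))))"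
    unfolding boxes .
  have "et ?C i T = (if boxes_of Plus ?sig = [] then None
      else Some (unflip n lam ((flip n lam T)(hd (boxes_of Plus ?sig) := n + 1 - i + 1))))"
    by (simp add: reverse_ssyt_crystal_def ssyt_crystal_def tableau_f_def Let_def)
  then have et: "et ?C i T = (if vs = [] then None
      else Some (unflip n lam ((flip n lam T)(hd vs := n + 1 - i + 1))))"
    unfolding boxes .
  have ft_Some: "f_step n lam i T (last us) (T(last us := i + 1)) \<and>
      ft ?C i T = Some (T(last us := i + 1))" if "us \<noteq> []"
  proof -
    have low: "f_step n lam i T (last us) (T(last us := i + 1))"
      using minus[OF that] height_le_top[OF lam] by (simp add: f_step_def)
    then show ?thesis
      using ft that flip_update[of "last us" "i + 1"] minus[OF that]
        unflip_flip[OF f_step_in[OF T i low]] by simp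
  qed
  have et_Some: "e_step n lam i T (hd vs) (T(hd vs := i)) \<and>
      et ?C i T = Some (T(hd vs := i))" if "vs \<noteq> []"
  proof -
    have up: "e_step n lam i T (hd vs) (T(hd vs := i))"
      using plus[OF that] height_le_top[OF lam] by (simp add: e_step_def)
    have "n + 1 - i + 1 = n + 2 - i" using i unfolding atLeastAtMost_iff by arith
    then show ?thesis
      using et that flip_update[of "hd vs" i] plus[OF that]
        unflip_flip[OF e_step_in[OF T i up]] up by simp
  qed
  show "ft ?C i T = None \<longleftrightarrow> total_height n lam i T = ?top"
    using ft us by auto
  show "et ?C i T = None \<longleftrightarrow> ?top = 0"
    using et vs by auto
  show "ft ?C i T = Some T' \<longleftrightarrow> (\<exists>b. f_step n lam i T b T')"
  proof (cases "us = []")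
    case True
    then show ?thesis using ft us total_less_top by fastforce
  next
    case False
    then have "T' = T(last us := i + 1)" if "f_step n lam i T b T'" for b
      using that f_step_unique ft_Some by (metis f_step_def)
    then show ?thesis using ft_Some[OF False] by auto
  qed
  show "et ?C i T = Some T' \<longleftrightarrow> (\<exists>b. e_step n lam i T b T')"
  proof (cases "vs = []")
    case True
    then show ?thesis using et vs top_positive by fastforce
  next
    case False
    then have "T' = T(hd vs := i)" if "e_step n lam i T b T'" for b
      using that e_step_unique et_Some by (metis e_step_def)
    then show ?thesis using et_Some[OF False] by auto
  qed
qed

lemma total_height_card:
  "total_height n lam i T =
    int (card {b \<in> young n lam. T b = i + 1}) - int (card {b \<in> young n lam. T b = i})"
  unfolding total_height_def by (rule sum_box_sign[OF finite_young[OF lam]])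

text \<open>
  In the basis \<open>\<omega>\<^sub>1, \<dots>, \<omega>\<^sub>n\<close> the coordinates of the weight are differences of the multiplicities of
  consecutive entries, that is, negated heights of the whole reading.
\<close>

lemma tableau_wt_eq:
  "tableau_wt n lam T k = (if k \<in> {1..n} then - total_height n lam k T else 0)"
proof -
  let ?c = "\<lambda>i. int (card {b \<in> young n lam. T b = i})"
  have eps: "epsilon n i k = (if k \<in> {1..n} then
      (if i = k then 1 else 0) - (if i = k + 1 then 1 else 0) else 0)" if "i \<in> {1..n + 1}" for i
    using that by (auto simp: epsilon_def omega_def)
  have "tableau_wt n lam T k = (\<Sum>i=1..n + 1. ?c i * (if k \<in> {1..n} then
      (if i = k then 1 else 0) - (if i = k + 1 then 1 else 0) else 0))"
    unfolding tableau_wt_def by (intro sum.cong) (auto simp only: eps)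
  also have "\<dots> = (if k \<in> {1..n} then ?c k - ?c (k + 1) else 0)"
    by (auto simp: right_diff_distrib sum_subtractf if_distrib[of "\<lambda>x. _ * x"] sum.delta
        simp del: sum.cl_ivl_Suc cong: if_cong)
  finally show ?thesis by (simp add: total_height_card)
qed

lemma f_step_data:
  assumes T: "T \<in> reverse_ssyt n lam" and i: "i \<in> {1..n}" and low: "f_step n lam i T b T'"
  shows "top_height n lam i T' = top_height n lam i T + 1"
    and "total_height n lam i T' = total_height n lam i T + 2"
    and "tableau_wt n lam T' k = tableau_wt n lam T k - alpha n i k"
proof -
  note T' = f_step_in[OF T i low]
  have i1: "1 \<le> i" using i by simp
  have up: "e_step n lam i T' b T" using low f_step_iff_e_step[OF T T' i1] by simp
  have b: "b \<in> young n lam" "T b = i" "T' = T(b := i + 1)" using low by (auto simp: f_step_def)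
  have "height n lam i T' (next_box b) = height n lam i T (next_box b)"
    using height_update[OF b(1)] later_next b(3) by simp
  moreover have "box_sign i T' b = 1" using b(3) by (simp add: box_sign_def)
  ultimately show "top_height n lam i T' = top_height n lam i T + 1"
    using height_next[OF T' i1, of b] unfolding e_step_top[OF up] f_step_top[OF low] by simp
  have total: "total_height n lam k T' = total_height n lam k T + box_sign k T' b - box_sign k T b" for k
    using total_height_update[OF b(1)] b(3) by simp
  show "total_height n lam i T' = total_height n lam i T + 2"
    using total[of i] b by (simp add: box_sign_def)
  show "tableau_wt n lam T' k = tableau_wt n lam T k - alpha n i k"
    using total[of k] b unfolding tableau_wt_eq alpha_apply[OF i] by (auto simp: box_sign_def)
qed

theorem reverse_ssyt_is_crystal: "is_crystal n (reverse_ssyt_crystal n lam)"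
  unfolding is_crystal_def reverse_crystal_simps
proof (intro conjI ballI allI impI)
  let ?C = "reverse_ssyt_crystal n lam"
  fix T assume T: "T \<in> reverse_ssyt n lam"
  show "tableau_wt n lam T \<in> weight_lattice n"
    by (simp add: weight_lattice_def tableau_wt_eq)
  fix i assume i: "i \<in> {1..n}"
  then have i1: "1 \<le> i" by simp
  note ops = reverse_crystal_operators[OF T i]
  show "ft ?C i T \<in> with_zero ?C"
    unfolding with_zero_def reverse_crystal_simps using ops(3) f_step_in[OF T i]
    by (cases "ft ?C i T") blast+
  show "et ?C i T \<in> with_zero ?C"
    unfolding with_zero_def reverse_crystal_simps using ops(4) e_step_in[OF T i]
    by (cases "et ?C i T") blast+
  show "phi ?C i T = shift (eps ?C i T) (pairing i (tableau_wt n lam T))"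
    using i by (simp add: ops(1,2) pairing_def tableau_wt_eq)
  show "et ?C i T = None" "ft ?C i T = None" if "phi ?C i T = MInf"
    using that ops(2) by simp_all
  show "ft ?C i T = Some T' \<longleftrightarrow> et ?C i T' = Some T" if T': "T' \<in> reverse_ssyt n lam" for T'
    using ops(3) reverse_crystal_operators(4)[OF T' i] f_step_iff_e_step[OF T T' i1] by simp
  {
    fix T' assume "ft ?C i T = Some T'"
    then obtain b where low: "f_step n lam i T b T'" using ops(3) by blast
    note T' = f_step_in[OF T i low]
    note data = f_step_data[OF T i low]
    show "tableau_wt n lam T' = (\<lambda>k. tableau_wt n lam T k - alpha n i k)"
      using data(3) by blast
    show "eps ?C i T' = shift (eps ?C i T) 1" "phi ?C i T' = shift (phi ?C i T) (- 1)"
      using data(1,2) by (simp_all add: ops(1,2) reverse_crystal_operators(1,2)[OF T' i])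
  }
  {
    fix T' assume "et ?C i T = Some T'"
    then obtain b where up: "e_step n lam i T b T'" using ops(4) by blast
    note T' = e_step_in[OF T i up]
    then have "f_step n lam i T' b T" using up f_step_iff_e_step[OF T' T i1] by simp
    note data = f_step_data[OF T' i this]
    show "tableau_wt n lam T' = (\<lambda>k. tableau_wt n lam T k + alpha n i k)"
      using data(3) by force
    show "eps ?C i T' = shift (eps ?C i T) (- 1)" "phi ?C i T' = shift (phi ?C i T) 1"
      using data(1,2) by (simp_all add: ops(1,2) reverse_crystal_operators(1,2)[OF T' i])
  }
qed

end

section \<open>Gelfand-Tsetlin patterns\<close>

text \<open>
  The value \<open>0\<close> at \<open>m = n + 1\<close>, where \<open>xc\<close> would run into the next
  block of \<open>n\<close> coordinates, makes the formulas below uniform at the boundary.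
\<close>

definition coord :: "nat \<Rightarrow> (nat \<Rightarrow> int) \<Rightarrow> nat \<Rightarrow> nat \<Rightarrow> int" where
  "coord n x l m = (if m \<le> n then xc n x l m else 0)"

text \<open>
  The length of row \<open>r\<close> of \<open>\<Lambda>\<^sub>i(x)\<close>, that is, the intended number of entries \<open>\<ge> i\<close> in row \<open>r\<close>.
\<close>

definition pattern :: "nat \<Rightarrow> weight \<Rightarrow> (nat \<Rightarrow> int) \<Rightarrow> nat \<Rightarrow> nat \<Rightarrow> int" where
  "pattern n lam x i r = coord n x r (i - 1) + part n lam (r + i - 1)"

definition encodes :: "nat \<Rightarrow> filling \<Rightarrow> (nat \<Rightarrow> nat \<Rightarrow> int) \<Rightarrow> bool" where
  "encodes n T g \<longleftrightarrow> (\<forall>i\<in>{1..n + 2}. \<forall>r\<ge>1. 0 \<le> g i r \<and>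
    (\<forall>c\<ge>1. i \<le> T (r, c) \<longleftrightarrow> int c \<le> g i r))"

text \<open>
  The part of the definition of \<open>\<Sigma>\<^sub>\<iota>[\<lambda>]\<close> that fixes where \<open>x\<close> is supported; the remaining
  inequalities are automatic once the pattern of \<open>x\<close> comes from a tableau (\<open>psi_eqI\<close>).
\<close>

definition triangular :: "nat \<Rightarrow> (nat \<Rightarrow> int) \<Rightarrow> bool" where
  "triangular n x \<longleftrightarrow> x \<in> sequences \<and> (\<forall>i\<in>{1..n}. \<forall>j\<ge>1. i + j > n + 1 \<longrightarrow> xc n x j i = 0)"

lemma index_eq_iff:
  fixes n r s i i' :: nat
  assumes "i \<in> {1..n}" "i' \<in> {1..n}" "1 \<le> r" "1 \<le> s"
  shows "(r - 1) * n + i = (s - 1) * n + i' \<longleftrightarrow> r = s \<and> i = i'"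
proof
  assume eq: "(r - 1) * n + i = (s - 1) * n + i'"
  then have "i = i'" using iota_index[OF assms(3,1)] iota_index[OF assms(4,2)] by simp
  then show "r = s \<and> i = i'" using eq assms by auto
qed simp

lemma index_cases:
  fixes n p :: nat
  assumes "1 \<le> p" "1 \<le> n"
  obtains l m where "1 \<le> l" "m \<in> {1..n}" "p = (l - 1) * n + m"
proof
  show "1 \<le> (p - 1) div n + 1" by simp
  show "(p - 1) mod n + 1 \<in> {1..n}" using assms(2) by (simp add: Suc_le_eq)
  have "p - 1 = (p - 1) div n * n + (p - 1) mod n" by simp
  then show "p = ((p - 1) div n + 1 - 1) * n + ((p - 1) mod n + 1)" using assms(1) by simp
qed

lemma coord_0 [simp]: "coord n x l 0 = 0"
  by (simp add: coord_def xc_def)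

lemma coord_big [simp]: "n < m \<Longrightarrow> coord n x l m = 0"
  by (simp add: coord_def)

lemma coord_index: "m \<in> {1..n} \<Longrightarrow> coord n x l m = x ((l - 1) * n + m)"
  by (simp add: coord_def xc_def)

lemma coord_zero:
  assumes "triangular n x" "1 \<le> l" "n + 1 < l + m"
  shows "coord n x l m = 0"
proof (cases "m = 0 \<or> n < m")
  case False
  then show ?thesis using assms by (simp add: triangular_def coord_def)
qed auto

lemma part_beyond: "n < k \<Longrightarrow> part n lam k = 0"
  by (simp add: part_def)

lemma part_diff: "i \<in> {1..n} \<Longrightarrow> part n lam i - part n lam (i + 1) = lam i"
  by (simp add: part_def sum.atLeast_Suc_atMost)

lemma encodesD:
  assumes "encodes n T g" "i \<in> {1..n + 2}" "1 \<le> r"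
  shows "0 \<le> g i r" and "1 \<le> c \<Longrightarrow> i \<le> T (r, c) \<longleftrightarrow> int c \<le> g i r"
  using assms unfolding encodes_def by blast+

lemma encodes_unique:
  assumes "encodes n T g" "encodes n T h" "i \<in> {1..n + 2}" "1 \<le> r"
  shows "g i r = h i r"
proof -
  have "g i r \<le> h i r" if "encodes n T g" "encodes n T h" for g h
  proof (cases "g i r \<ge> 1")
    case True
    then show ?thesis
      using encodesD(2)[OF that(1) assms(3,4), of "nat (g i r)"]
        encodesD(2)[OF that(2) assms(3,4), of "nat (g i r)"] by simp
  next
    case False
    then show ?thesis using encodesD(1)[OF that(2) assms(3,4)] by simp
  qed
  then show ?thesis using assms(1,2) by (simp add: order_antisym)
qed

context
  fixes n :: nat and lam :: weight
  assumes lam: "lam \<in> dominant_weights n" and n: "1 \<le> n"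
begin

lemma part_nonneg: "0 \<le> part n lam k"
proof -
  have "part n lam (max k (n + 1)) \<le> part n lam k" by (intro part_antimono[OF lam]) simp
  then show ?thesis using part_beyond[of n "max k (n + 1)" lam] by simp
qed

lemma pattern_beyond:
  assumes "triangular n x" "1 \<le> r" "1 \<le> i" "n + 2 < r + i \<or> i = n + 2 \<or> n < r"
  shows "pattern n lam x i r = 0"
proof (cases "n + 2 < r + i")
  case True
  then show ?thesis using coord_zero[OF assms(1,2), of "i - 1"] by (simp add: pattern_def part_beyond)
next
  case False
  then show ?thesis using assms by (auto simp: pattern_def part_beyond)
qed

text \<open>
  These are the defining inequalities of \<open>\<Sigma>\<^sub>\<iota>[\<lambda>]\<close> shifted by the parts of \<open>\<lambda>\<close>. Only for
  \<open>r + i = n + 2\<close> does the first one need an argument: there it says that a coordinate is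
  nonnegative, which follows by descending the chain \<open>x\<^sub>k\<^sup>(\<^sup>j\<^sup>) \<ge> x\<^sub>k\<^sub>+\<^sub>1\<^sup>(\<^sup>j\<^sup>-\<^sup>1\<^sup>) \<ge> \<dots> \<ge> 0\<close>.
\<close>

lemma pattern_interlacing:
  assumes x: "x \<in> Sigma_set n lam" and i: "i \<in> {1..n + 1}" and r: "1 \<le> r"
  shows "pattern n lam x (i + 1) r \<le> pattern n lam x i r"
    and "pattern n lam x i (r + 1) \<le> pattern n lam x (i + 1) r"
proof -
  have tri: "triangular n x" using x by (simp add: Sigma_set_def triangular_def)
  have chain: "coord n x (k + 1) (j - 1) \<le> coord n x k j" if "1 \<le> j" "1 \<le> k" for j k
  proof (cases "j + k \<le> n + 1")
    case True
    define i' where "i' = j + k - 1"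
    have i': "i' \<in> {1..n}" "j = i' - k + 1" "k \<le> i'" using that True by (auto simp: i'_def)
    show ?thesis
    proof (cases "k = i'")
      case True
      then have "j = 1" using i' by simp
      moreover have "0 \<le> xc n x i' 1" using x i'(1) by (simp add: Sigma_set_def)
      ultimately show ?thesis using True n by (simp add: coord_def xc_def)
    next
      case False
      then have "k \<in> {1..<i'}" using i' that by simp
      then have "xc n x (k + 1) (i' - k) \<le> xc n x k (i' - k + 1)"
        using x i'(1) by (simp add: Sigma_set_def)
      then show ?thesis using i' that by (auto simp: coord_def)
    qed
  next
    case False
    then show ?thesis
      using coord_zero[OF tri that(2), of j] coord_zero[OF tri, of "k + 1" "j - 1"] that by simp
  qed
  show "pattern n lam x i (r + 1) \<le> pattern n lam x (i + 1) r"
    using chain[of i r] i r by (simp add: pattern_def)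
  have nonneg: "0 \<le> coord n x k j" if "1 \<le> k" for j k
    using that
  proof (induction j arbitrary: k)
    case (Suc j)
    then have "0 \<le> coord n x (k + 1) j" by simp
    also have "\<dots> \<le> coord n x k (Suc j)" using chain[of "Suc j" k] Suc.prems by simp
    finally show ?case .
  qed simp
  show "pattern n lam x (i + 1) r \<le> pattern n lam x i r"
  proof (cases "r + i \<le> n + 1")
    case True
    define i' where "i' = r + i - 1"
    have i': "i' \<in> {1..n}" "r \<in> {1..i'}" "i' - r = i - 1" "i' - r + 1 = i"
      using i r True by (auto simp: i'_def)
    have "part n lam i' - part n lam (i' + 1) \<ge> xc n x r (i' - r + 1) - xc n x r (i' - r)"
      using x i'(1,2) by (simp add: Sigma_set_def)
    then have "part n lam i' - part n lam (i' + 1) \<ge> xc n x r i - xc n x r (i - 1)"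
      unfolding i'(4) unfolding i'(3) .
    moreover have "i \<le> n" "i - 1 \<le> n" using True r by simp_all
    ultimately show ?thesis using i r by (simp add: pattern_def coord_def i'_def)
  next
    case False
    then have "pattern n lam x (i + 1) r = 0" using pattern_beyond[OF tri r, of "i + 1"] by simp
    then show ?thesis using nonneg[OF r] part_nonneg by (simp add: pattern_def)
  qed
qed

lemma triangular_if_Sigma: "x \<in> Sigma_set n lam \<Longrightarrow> triangular n x"
  by (simp add: Sigma_set_def triangular_def)

lemma pattern_top: "pattern n lam x (Suc 0) r = part n lam r"
  by (simp add: pattern_def)

lemma pattern_antimono:
  assumes "x \<in> Sigma_set n lam" "1 \<le> r" "1 \<le> i" "i \<le> j" "j \<le> n + 2"
  shows "pattern n lam x j r \<le> pattern n lam x i r"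
  using assms(4,5)
proof (induction rule: dec_induct)
  case (step m)
  then show ?case using pattern_interlacing(1)[OF assms(1) _ assms(2), of m] assms(3) by simp
qed simp

lemma pattern_nonneg:
  assumes "x \<in> Sigma_set n lam" "1 \<le> r" "i \<in> {1..n + 2}"
  shows "0 \<le> pattern n lam x i r"
  using pattern_antimono[OF assms(1,2), of i "n + 2"] assms(3)
    pattern_beyond[OF triangular_if_Sigma[OF assms(1)] assms(2), of "n + 2"] by simp

text \<open>
  For a box in the diagram the indices \<open>j\<close> with \<open>(r, c) \<in> \<Lambda>\<^sub>j(x)\<close> form an initial interval
  because row lengths decrease in \<open>j\<close>; its largest element is the entry of \<open>T\<^sub>x\<close>.
\<close>

lemma psi_encodes:
  assumes x: "x \<in> Sigma_set n lam"
  shows "encodes n (psi n lam x) (pattern n lam x)"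
  unfolding encodes_def
proof (intro ballI allI impI conjI)
  fix i r :: nat assume i: "i \<in> {1..n + 2}" and r: "1 \<le> r"
  show "0 \<le> pattern n lam x i r" using pattern_nonneg[OF x r i] .
  fix c :: nat assume c: "1 \<le> c"
  note tri = triangular_if_Sigma[OF x]
  note anti = pattern_antimono[OF x r]
  have Lam: "(r, c) \<in> Lam n lam x j \<longleftrightarrow> int c \<le> pattern n lam x j r" if j: "j \<in> {1..n + 2}" for j
  proof (cases "r \<le> n + 2 - j")
    case True
    then have "j - 1 \<le> n" using r by simp
    then show ?thesis using True r c by (simp add: Lam_def diagram_def pattern_def coord_def)
  next
    case False
    then have "n + 2 < r + j" using j by auto
    then have "pattern n lam x j r = 0" using pattern_beyond[OF tri r, of j] j by auto
    then show ?thesis using False c by (simp add: Lam_def diagram_def)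
  qed
  show "i \<le> psi n lam x (r, c) \<longleftrightarrow> int c \<le> pattern n lam x i r"
  proof (cases "(r, c) \<in> young n lam")
    case False
    then have "pattern n lam x 1 r < int c" using young_iff[OF lam] r c by (simp add: pattern_top)
    then have "\<not> int c \<le> pattern n lam x i r" using anti[of 1 i] i by simp
    then show ?thesis using False i by (simp add: psi_def)
  next
    case True
    define J where "J = {j \<in> {1..n + 1}. int c \<le> pattern n lam x j r}"
    have J: "finite J" "1 \<in> J"
      using True young_iff[OF lam] by (auto simp: J_def pattern_top)
    define m where "m = Max J"
    have m: "m \<in> J" "\<And>j. j \<in> J \<Longrightarrow> j \<le> m"
      using J(2) Max_in[OF J(1)] Max_ge[OF J(1)] by (auto simp: m_def)
    have last: "pattern n lam x (n + 2) r = 0" using pattern_beyond[OF tri r] by simp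
    have above: "pattern n lam x j r < int c" if "m < j" "j \<le> n + 2" for j
    proof (cases "j = n + 2")
      case True
      then show ?thesis using last c by simp
    next
      case False
      moreover have "j \<notin> J" using m(2)[of j] that(1) by auto
      ultimately show ?thesis using that by (auto simp: J_def not_le)
    qed
    have below: "int c \<le> pattern n lam x j r" if "1 \<le> j" "j \<le> m" for j
      using anti[of j m] that m(1) by (auto simp: J_def)
    have m_range: "m \<in> {1..n + 1}" using m(1) by (simp add: J_def)
    have "psi n lam x (r, c) = (THE j. j \<in> {1..n + 1} \<and> (r, c) \<in> Lam n lam x j - Lam n lam x (j + 1))"
      using True by (simp add: psi_def)
    also have "\<dots> = m"
    proof (rule the_equality)
      show "m \<in> {1..n + 1} \<and> (r, c) \<in> Lam n lam x m - Lam n lam x (m + 1)"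
        using m_range below[of m] above[of "m + 1"] Lam[of m] Lam[of "m + 1"] by auto
      fix j assume j: "j \<in> {1..n + 1} \<and> (r, c) \<in> Lam n lam x j - Lam n lam x (j + 1)"
      then have "int c \<le> pattern n lam x j r" "\<not> int c \<le> pattern n lam x (j + 1) r"
        using Lam[of j] Lam[of "j + 1"] by auto
      then show "j = m"
        using above[of j] below[of "j + 1"] j by (cases j m rule: linorder_cases) auto
    qed
    finally show ?thesis using below[of i] above[of i] i by (meson atLeastAtMost_iff linorder_not_le)
  qed
qed

lemma psi_in_reverse:
  assumes x: "x \<in> Sigma_set n lam"
  shows "psi n lam x \<in> reverse_ssyt n lam"
proof -
  let ?T = "psi n lam x"
  have enc: "i \<le> ?T (r, c) \<longleftrightarrow> int c \<le> pattern n lam x i r"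
    if "i \<in> {1..n + 2}" "1 \<le> r" "1 \<le> c" for i r c
    using psi_encodes[OF x] that by (simp add: encodes_def)
  have bound: "?T (r, c) \<le> n + 1" if "1 \<le> r" "1 \<le> c" for r c
    using enc[of "n + 2" r c] that pattern_beyond[OF triangular_if_Sigma[OF x] that(1), of "n + 2"]
    by simp
  have pos: "1 \<le> ?T (r, c) \<longleftrightarrow> (r, c) \<in> young n lam" if "1 \<le> r" "1 \<le> c" for r c
    using enc[of 1 r c] that young_iff[OF lam] by (simp add: pattern_top)
  have "?T \<in> fillings n lam"
    unfolding fillings_def
  proof (intro CollectI conjI ballI allI impI)
    fix b assume b: "b \<in> young n lam"
    obtain r c where rc: "b = (r, c)" by (cases b)
    then show "?T b \<in> {1..n + 1}" using b bound[of r c] pos[of r c] young_iff[OF lam] by simp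
  qed (simp add: psi_def)
  moreover have "?T (r, c + 1) \<le> ?T (r, c)" if rc: "1 \<le> r" "1 \<le> c" for r c
  proof (cases "?T (r, c + 1) = 0")
    case False
    let ?t = "?T (r, c + 1)"
    have "?t \<in> {1..n + 2}" using False bound[of r "c + 1"] rc by simp
    then show ?thesis using enc[of ?t r "c + 1"] enc[of ?t r c] rc by simp
  qed simp
  moreover have "?T (r + 1, c) \<le> ?T (r, c) - 1" if rc: "1 \<le> r" "1 \<le> c" for r c
  proof (cases "?T (r + 1, c) = 0")
    case False
    let ?t = "?T (r + 1, c)"
    have t: "?t \<in> {1..n + 1}" using False bound[of "r + 1" c] rc by simp
    then have "int c \<le> pattern n lam x ?t (r + 1)" using enc[of ?t "r + 1" c] rc by simp
    also have "\<dots> \<le> pattern n lam x (?t + 1) r" using pattern_interlacing(2)[OF x t rc(1)] .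
    finally have "?t + 1 \<le> ?T (r, c)" using enc[of "?t + 1" r c] rc t by simp
    then show ?thesis by simp
  qed simp
  ultimately show ?thesis using reverse_ssyt_iff[OF lam] by blast
qed

lemma tableau_eqI:
  assumes "T \<in> reverse_ssyt n lam" "T' \<in> reverse_ssyt n lam" "encodes n T g" "encodes n T' g"
  shows "T = T'"
proof
  fix b :: box
  obtain r c where b: "b = (r, c)" by (cases b)
  show "T b = T' b"
  proof (cases "(r, c) \<in> young n lam")
    case True
    have rc: "1 \<le> r" "1 \<le> c" using True young_iff[OF lam] by auto
    have "T b \<in> {1..n + 2}" "T' b \<in> {1..n + 2}"
      using True b fillings_if_reverse[OF lam assms(1)] fillings_if_reverse[OF lam assms(2)]
      by (auto simp: fillings_def)
    then show ?thesis using assms(3,4) rc b unfolding encodes_def by (metis order_antisym order_refl)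
  next
    case False
    then show ?thesis using outside[OF lam assms(1)] outside[OF lam assms(2)] b by simp
  qed
qed

text \<open>
  To show that \<open>x\<close> lies in \<open>\<Sigma>\<^sub>\<iota>[\<lambda>]\<close> it suffices to exhibit its tableau, as the interlacing
  inequalities express that rows decrease weakly and columns strictly.
\<close>

lemma psi_eqI:
  assumes tri: "triangular n x" and T: "T \<in> reverse_ssyt n lam"
    and enc: "encodes n T (pattern n lam x)"
  shows "x \<in> Sigma_set n lam \<and> psi n lam x = T"
proof -
  have E: "i \<le> T (r, c) \<longleftrightarrow> int c \<le> pattern n lam x i r"
    if "i \<in> {1..n + 2}" "1 \<le> r" "1 \<le> c" for i r c
    using enc that by (simp add: encodes_def)
  have nonneg: "0 \<le> pattern n lam x i r" if "i \<in> {1..n + 2}" "1 \<le> r" for i r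
    using enc that by (simp add: encodes_def)
  have le1: "coord n x r i + part n lam (r + i) \<le> coord n x r (i - 1) + part n lam (r + i - 1)"
    if i: "i \<in> {1..n + 1}" and r: "1 \<le> r" for i r
  proof (cases "1 \<le> pattern n lam x (i + 1) r")
    case True
    then have "i + 1 \<le> T (r, nat (pattern n lam x (i + 1) r))" using E[of "i + 1"] i r by simp
    then have "pattern n lam x (i + 1) r \<le> pattern n lam x i r"
      using E[of i r "nat (pattern n lam x (i + 1) r)"] i r True by simp
    then show ?thesis using r by (simp add: pattern_def)
  next
    case False
    then show ?thesis using nonneg[of i r] i r by (simp add: pattern_def)
  qed
  have le2: "coord n x (r + 1) (i - 1) \<le> coord n x r i" if i: "i \<in> {1..n + 1}" and r: "1 \<le> r" for i r
  proof -
    have "pattern n lam x i (r + 1) \<le> pattern n lam x (i + 1) r"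
    proof (cases "1 \<le> pattern n lam x i (r + 1)")
      case True
      let ?c = "nat (pattern n lam x i (r + 1))"
      have "i \<le> T (r + 1, ?c)" using E[of i "r + 1" ?c] i r True by simp
      moreover have "T (r + 1, ?c) \<le> T (r, ?c) - 1" using column_drop[OF lam T r, of ?c 1] True by simp
      ultimately have "i + 1 \<le> T (r, ?c)" using i unfolding atLeastAtMost_iff by arith
      then show ?thesis using E[of "i + 1" r ?c] i r True by simp
    next
      case False
      then show ?thesis using nonneg[of "i + 1" r] i r by simp
    qed
    then show ?thesis using i by (simp add: pattern_def)
  qed
  have "x \<in> Sigma_set n lam"
    unfolding Sigma_set_def
  proof (intro CollectI conjI ballI allI impI)
    show "x \<in> sequences" using tri by (simp add: triangular_def)
    fix i assume i: "i \<in> {1..n}"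
    show "xc n x (j + 1) (i - j) \<le> xc n x j (i - j + 1)" if "j \<in> {1..<i}" for j
    proof -
      have "i - j + 1 \<le> n" using i that by auto
      then show ?thesis using le2[of "i - j + 1" j] that by (simp add: coord_def)
    qed
    show "0 \<le> xc n x i 1" using le2[of 1 i] i n by (simp add: coord_def xc_def)
    show "xc n x j i = 0" if "1 \<le> j" "n + 1 < i + j" for j
      using tri i that by (simp add: triangular_def)
    show "xc n x j (i - j + 1) - xc n x j (i - j) \<le> part n lam i - part n lam (i + 1)"
      if "j \<in> {1..i}" for j
    proof -
      have "i - j + 1 \<le> n" using i that by auto
      then show ?thesis using le1[of "i - j + 1" j] that by (simp add: coord_def)
    qed
  qed
  then show ?thesis
    using tableau_eqI[OF psi_in_reverse T psi_encodes enc] by blast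
qed

lemma psi_inj: "inj_on (psi n lam) (Sigma_set n lam)"
proof (intro inj_onI ext)
  fix x y p assume x: "x \<in> Sigma_set n lam" and y: "y \<in> Sigma_set n lam"
    and eq: "psi n lam x = psi n lam y"
  show "x p = y p"
  proof (cases "p = 0")
    case True
    then show ?thesis using x y by (simp add: Sigma_set_def sequences_def)
  next
    case False
    then obtain l m where lm: "1 \<le> l" "m \<in> {1..n}" "p = (l - 1) * n + m"
      using index_cases[of p n] n by auto
    have "pattern n lam x (m + 1) l = pattern n lam y (m + 1) l"
      using psi_encodes[OF x] psi_encodes[OF y] lm eq by (intro encodes_unique[of n "psi n lam x"]) auto
    then show ?thesis using lm by (simp add: pattern_def coord_index)
  qed
qed

lemma initial_interval:
  fixes A :: "nat set"
  assumes "finite A" "\<And>a. a \<in> A \<Longrightarrow> 1 \<le> a" "\<And>a b. a \<in> A \<Longrightarrow> 1 \<le> b \<Longrightarrow> b \<le> a \<Longrightarrow> b \<in> A"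
  shows "A = {1..card A}"
proof (cases "A = {}")
  case False
  have "A = {1..Max A}"
  proof (intro set_eqI iffI)
    fix b assume "b \<in> A"
    then show "b \<in> {1..Max A}" using assms(2)[of b] Max_ge[OF assms(1), of b] by simp
  next
    fix b assume "b \<in> {1..Max A}"
    then show "b \<in> A" using assms(3)[OF Max_in[OF assms(1) False], of b] by simp
  qed
  then have "card A = Max A" by (metis card_atLeastAtMost diff_Suc_1)
  then show ?thesis using \<open>A = {1..Max A}\<close> by simp
qed simp

text \<open>
  The preimage is read off from the row counts \<open>g i r\<close> of entries \<open>\<ge> i\<close> in row \<open>r\<close>; rows being
  decreasing, these entries fill the first \<open>g i r\<close> columns.
\<close>

lemma psi_surj:
  assumes T: "T \<in> reverse_ssyt n lam"
  shows "\<exists>x\<in>Sigma_set n lam. psi n lam x = T"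
proof -
  define A where "A i r = {c. 1 \<le> c \<and> i \<le> T (r, c)}" for i r
  define g where "g i r = int (card (A i r))" for i r
  have A_sub: "A i r \<subseteq> {1..nat (part n lam r)}" if "1 \<le> i" for i r
  proof
    fix c assume c: "c \<in> A i r"
    then have "T (r, c) \<noteq> 0" using that by (auto simp: A_def)
    then have "(r, c) \<in> young n lam" using outside[OF lam T] by metis
    then show "c \<in> {1..nat (part n lam r)}" using young_iff[OF lam] by auto
  qed
  have A: "A i r = {1..card (A i r)}" if "1 \<le> i" "1 \<le> r" for i r
  proof (rule initial_interval)
    show "finite (A i r)" using A_sub[OF that(1)] finite_subset by blast
    show "b \<in> A i r" if "a \<in> A i r" "1 \<le> b" "b \<le> a" for a b
      using that row_mono[OF lam T \<open>1 \<le> r\<close>, of b a] by (auto simp: A_def)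
  qed (simp add: A_def)
  have enc: "i \<le> T (r, c) \<longleftrightarrow> int c \<le> g i r" if "1 \<le> i" "1 \<le> r" "1 \<le> c" for i r c
  proof -
    have "i \<le> T (r, c) \<longleftrightarrow> c \<in> A i r" using that by (simp add: A_def)
    also have "\<dots> \<longleftrightarrow> c \<in> {1..card (A i r)}" using A[OF that(1,2)] by blast
    finally show ?thesis using that by (simp add: g_def)
  qed
  have g_top: "g 1 r = part n lam r" if r: "1 \<le> r" for r
  proof -
    have "A 1 r = {1..nat (part n lam r)}"
    proof
      show "{1..nat (part n lam r)} \<subseteq> A 1 r"
      proof
        fix c assume "c \<in> {1..nat (part n lam r)}"
        then have "(r, c) \<in> young n lam" "1 \<le> c" using young_iff[OF lam] r by auto
        then show "c \<in> A 1 r"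
          using fillings_if_reverse[OF lam T] by (auto simp: A_def fillings_def)
      qed
    qed (use A_sub in simp)
    then show ?thesis using part_nonneg by (simp add: g_def)
  qed
  have g_zero: "g i r = 0" if ri: "1 \<le> r" "1 \<le> i" "n + 2 < r + i" for i r
  proof -
    have "\<not> i \<le> T (r, c)" if "1 \<le> c" for c
      using entry_plus_row_le[OF lam T ri(1) that] ri by linarith
    then have "A i r = {}" by (auto simp: A_def)
    then show ?thesis by (simp add: g_def)
  qed
  define x where "x p = (let l = (p - 1) div n + 1; m = iota n p in
    if 1 \<le> p \<and> l + m \<le> n + 1 then g (m + 1) l - part n lam (l + m) else 0)" for p
  have x_index: "x ((l - 1) * n + m) = (if l + m \<le> n + 1 then g (m + 1) l - part n lam (l + m) else 0)"
    if l: "1 \<le> l" and m: "m \<in> {1..n}" for l m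
  proof -
    have "((l - 1) * n + m - 1) div n = l - 1"
    proof -
      have "(l - 1) * n + m - 1 = (m - 1) + (l - 1) * n" using m by simp
      moreover have "m - 1 < n" using m by auto
      ultimately show ?thesis using n by simp
    qed
    moreover have "1 \<le> (l - 1) * n + m" using m by simp
    ultimately show ?thesis using iota_index[OF l m] l by (simp add: x_def Let_def)
  qed
  have "{p. x p \<noteq> 0} \<subseteq> {..n * n}"
  proof
    fix p assume "p \<in> {p. x p \<noteq> 0}"
    then have p: "1 \<le> p" "x p \<noteq> 0" by (auto simp: x_def Let_def split: if_splits)
    then obtain l m where lm: "1 \<le> l" "m \<in> {1..n}" "p = (l - 1) * n + m"
      using index_cases[of p n] n by auto
    then have "l \<le> n" using p(2) x_index[OF lm(1,2)] by (auto split: if_splits)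
    then have "(l - 1) * n \<le> (n - 1) * n" by (intro mult_right_mono) auto
    then have "p \<le> (n - 1) * n + n" unfolding lm(3) using lm(2) by (intro add_mono) auto
    also have "\<dots> = n * n" using n by (cases n) auto
    finally show "p \<in> {..n * n}" by simp
  qed
  then have "x \<in> sequences" by (auto simp: sequences_def x_def intro: finite_subset)
  then have tri: "triangular n x" using x_index by (auto simp: triangular_def xc_def)
  have pattern_g: "pattern n lam x i r = g i r" if i: "i \<in> {1..n + 2}" and r: "1 \<le> r" for i r
  proof -
    consider "n + 2 < r + i" | "i = 1" | "r + i \<le> n + 2" "i \<noteq> 1" by linarith
    then show ?thesis
    proof cases
      case 1
      then show ?thesis using pattern_beyond[OF tri r, of i] g_zero[OF r, of i] i by simp
    next
      case 2
      then show ?thesis using g_top[OF r] by (simp add: pattern_top)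
    next
      case 3
      have "i = i - 1 + 1" "i - 1 \<in> {1..n}" using 3 i r by auto
      then obtain m where m: "i = m + 1" "m \<in> {1..n}" by blast
      then show ?thesis using 3 x_index[OF r m(2)] coord_index[OF m(2), of x r]
        by (simp add: pattern_def)
    qed
  qed
  have "encodes n T (pattern n lam x)"
    using enc pattern_g by (auto simp: encodes_def g_def)
  then show ?thesis using psi_eqI[OF tri T] by blast
qed

lemma psi_bij: "bij_betw (psi n lam) (Sigma_set n lam) (reverse_ssyt n lam)"
  using psi_inj psi_in_reverse psi_surj by (auto simp: bij_betw_def)

end

section \<open>The functions \<open>\<sigma>\<close> as heights\<close>

lemma neighbour_sum:
  assumes i: "i \<in> {1..n}" and v: "v 0 = 0" "v (n + 1) = 0"
  shows "(\<Sum>m=1..n. alpha n m i * v m) = 2 * v i - v (i - 1) - (v (i + 1) :: int)"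
proof -
  have "(\<Sum>m=1..n. alpha n m i * v m) =
      (\<Sum>m=1..n. (if m = i then 2 * v m else 0) - (if m = i - 1 then v m else 0) -
        (if m = i + 1 then v m else 0))"
  proof (rule sum.cong)
    fix m assume "m \<in> {1..n}"
    then show "alpha n m i * v m = (if m = i then 2 * v m else 0) - (if m = i - 1 then v m else 0) -
        (if m = i + 1 then v m else 0)"
      using i by (auto simp: alpha_apply)
  qed simp
  also have "\<dots> = 2 * v i - (if i - 1 \<in> {1..n} then v (i - 1) else 0) -
      (if i + 1 \<in> {1..n} then v (i + 1) else 0)"
    using i by (simp add: sum_subtractf del: atLeastAtMost_iff)
  also have "\<dots> = 2 * v i - v (i - 1) - v (i + 1)"
  proof -
    have "(if i - 1 \<in> {1..n} then v (i - 1) else 0) = v (i - 1)"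
      using i v(1) by (cases "i = 1") auto
    moreover have "(if i + 1 \<in> {1..n} then v (i + 1) else 0) = v (i + 1)"
      using i v(2) by (cases "i = n") auto
    ultimately show ?thesis by simp
  qed
  finally show ?thesis .
qed

text \<open>
  The contribution of the block \<open>l\<close> of coordinates to \<open>\<langle>\<alpha>\<^sub>i\<^sup>\<or>, \<Sum> x\<^sub>j \<alpha>\<^bsub>i\<^sub>j\<^esub>\<rangle>\<close>, by the
  Cartan matrix of type \<open>A\<^sub>n\<close>.
\<close>

definition second_difference :: "nat \<Rightarrow> (nat \<Rightarrow> int) \<Rightarrow> nat \<Rightarrow> nat \<Rightarrow> int" where
  "second_difference n x i l = 2 * coord n x l i - coord n x l (i - 1) - coord n x l (i + 1)"

text \<open>
  The last box of row \<open>s\<close> with an entry \<open>\<ge> i + 1\<close>; a pair in column 0 if there is none.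
\<close>

definition row_end :: "nat \<Rightarrow> weight \<Rightarrow> (nat \<Rightarrow> int) \<Rightarrow> nat \<Rightarrow> nat \<Rightarrow> box" where
  "row_end n lam x i s = (s, nat (pattern n lam x (i + 1) s))"

context
  fixes n :: nat and lam :: weight
  assumes lam: "lam \<in> dominant_weights n" and n: "1 \<le> n"
begin

lemma sum_over_support:
  fixes G :: "nat \<Rightarrow> int"
  assumes tri: "triangular n x" and G: "\<And>p. x p = 0 \<Longrightarrow> G p = 0"
  shows "(\<Sum>p | 1 \<le> p \<and> x p \<noteq> 0. G p) = (\<Sum>l=1..n + 1. \<Sum>m=1..n. G ((l - 1) * n + m))"
proof -
  define h where "h = (\<lambda>(l, m). (l - 1) * n + m)"
  have inj: "inj_on h ({1..n + 1} \<times> {1..n})"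
  proof (rule inj_onI)
    fix a b assume ab: "a \<in> {1..n + 1} \<times> {1..n}" "b \<in> {1..n + 1} \<times> {1..n}" "h a = h b"
    obtain l m l' m' where "a = (l, m)" "b = (l', m')" by (cases a; cases b)
    then show "a = b" using ab index_eq_iff[of m n m' l l'] by (simp add: h_def)
  qed
  have "(\<Sum>l=1..n + 1. \<Sum>m=1..n. G ((l - 1) * n + m)) = (\<Sum>a\<in>{1..n + 1} \<times> {1..n}. G (h a))"
    by (simp add: sum.cartesian_product h_def split_def del: sum.cl_ivl_Suc)
  also have "\<dots> = sum G (h ` ({1..n + 1} \<times> {1..n}))"
    using sum.reindex[OF inj, of G] by simp
  also have "\<dots> = (\<Sum>p | 1 \<le> p \<and> x p \<noteq> 0. G p)"
  proof (rule sum.mono_neutral_right)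
    show "{p. 1 \<le> p \<and> x p \<noteq> 0} \<subseteq> h ` ({1..n + 1} \<times> {1..n})"
    proof
      fix p assume p: "p \<in> {p. 1 \<le> p \<and> x p \<noteq> 0}"
      then obtain l m where lm: "1 \<le> l" "m \<in> {1..n}" "p = (l - 1) * n + m"
        using index_cases[of p n] n by auto
      then have "coord n x l m \<noteq> 0" using p by (simp add: coord_index)
      then have "l + m \<le> n + 1" using coord_zero[OF tri lm(1)] by (meson not_le)
      then have "(l, m) \<in> {1..n + 1} \<times> {1..n}" using lm by simp
      then show "p \<in> h ` ({1..n + 1} \<times> {1..n})" using lm(3) by (force simp: h_def)
    qed
    show "\<forall>p\<in>h ` ({1..n + 1} \<times> {1..n}) - {p. 1 \<le> p \<and> x p \<noteq> 0}. G p = 0"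
      using G by (fastforce simp: h_def)
  qed simp
  finally show ?thesis ..
qed

lemma finite_support: "triangular n x \<Longrightarrow> finite {p. P p \<and> x p \<noteq> 0}"
  by (rule finite_subset[of _ "{p. x p \<noteq> 0}"]) (auto simp: triangular_def sequences_def)

lemma root_sum_eq:
  assumes tri: "triangular n x" and i: "i \<in> {1..n}"
  shows "(\<Sum>p | 1 \<le> p \<and> x p \<noteq> 0. alpha n (iota n p) i * x p) =
    (\<Sum>l=1..n + 1. second_difference n x i l)"
proof -
  have "(\<Sum>p | 1 \<le> p \<and> x p \<noteq> 0. alpha n (iota n p) i * x p) =
      (\<Sum>l=1..n + 1. \<Sum>m=1..n.
        alpha n (iota n ((l - 1) * n + m)) i * x ((l - 1) * n + m))"
    by (rule sum_over_support[OF tri]) simp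
  also have "\<dots> = (\<Sum>l=1..n + 1. \<Sum>m=1..n. alpha n m i * coord n x l m)"
  proof (intro sum.cong refl)
    fix l m assume lm: "l \<in> {1..n + 1}" "m \<in> {1..n}"
    then have l: "1 \<le> l" by simp
    show "alpha n (iota n ((l - 1) * n + m)) i * x ((l - 1) * n + m) = alpha n m i * coord n x l m"
      unfolding iota_index[OF l lm(2)] coord_index[OF lm(2)] ..
  qed
  also have "\<dots> = (\<Sum>l=1..n + 1. second_difference n x i l)"
    unfolding second_difference_def by (intro sum.cong neighbour_sum[OF i]) auto
  finally show ?thesis .
qed

text \<open>
  Positions after that of \<open>x\<^sub>s\<^sup>(\<^sup>i\<^sup>)\<close> are those in the later blocks and those with larger upper index
  in block \<open>s\<close>; of the latter only \<open>x\<^sub>s\<^sup>(\<^sup>i\<^sup>+\<^sup>1\<^sup>)\<close> pairs nontrivially with \<open>\<alpha>\<^sub>i\<^sup>\<or>\<close>.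
\<close>

lemma sigma_eq:
  assumes tri: "triangular n x" and i: "i \<in> {1..n}" and s: "1 \<le> s"
  shows "sigma n x ((s - 1) * n + i) =
    coord n x s i - coord n x s (i + 1) + (\<Sum>l=Suc s..n + 1. second_difference n x i l)"
proof -
  let ?k = "(s - 1) * n + i"
  let ?v = "\<lambda>l m. if s < l \<or> l = s \<and> i < m then coord n x l m else 0"
  have later_index: "?k < (l - 1) * n + m \<longleftrightarrow> s < l \<or> l = s \<and> i < m"
    if l: "1 \<le> l" and m: "m \<in> {1..n}" for l m
  proof -
    have block: "(a - 1) * n + i' < (b - 1) * n + j'"
      if "1 \<le> a" "a < b" "i' \<le> n" "1 \<le> j'" for a b i' j' :: nat
    proof -
      have "a * n \<le> (b - 1) * n" using that by (intro mult_right_mono) auto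
      moreover have "a * n = (a - 1) * n + n" using that(1) by (cases a) auto
      ultimately show ?thesis using that by linarith
    qed
    show ?thesis
      using block[of s l i m] block[of l s m i] i m l s
      by (cases s l rule: linorder_cases) auto
  qed
  have "(\<Sum>p | ?k < p \<and> x p \<noteq> 0. alpha n (iota n p) i * x p) =
      (\<Sum>p | 1 \<le> p \<and> x p \<noteq> 0. if ?k < p then alpha n (iota n p) i * x p else 0)"
    using finite_support[OF tri]
    by (intro sum.mono_neutral_cong_left) auto
  also have "\<dots> = (\<Sum>l=1..n + 1. \<Sum>m=1..n. if ?k < (l - 1) * n + m
      then alpha n (iota n ((l - 1) * n + m)) i * x ((l - 1) * n + m) else 0)"
    by (rule sum_over_support[OF tri]) simp
  also have "\<dots> = (\<Sum>l=1..n + 1. \<Sum>m=1..n. alpha n m i * ?v l m)"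
  proof (intro sum.cong refl)
    fix l m assume lm: "l \<in> {1..n + 1}" "m \<in> {1..n}"
    then have l: "1 \<le> l" by simp
    show "(if ?k < (l - 1) * n + m
      then alpha n (iota n ((l - 1) * n + m)) i * x ((l - 1) * n + m) else 0) = alpha n m i * ?v l m"
      unfolding later_index[OF l lm(2)] iota_index[OF l lm(2)] coord_index[OF lm(2)] by simp
  qed
  also have "\<dots> = (\<Sum>l=1..n + 1. 2 * ?v l i - ?v l (i - 1) - ?v l (i + 1))"
    by (intro sum.cong neighbour_sum[OF i]) auto
  also have "\<dots> = (\<Sum>l=1..n + 1. (if l = s then - coord n x s (i + 1) else 0) +
      (if s < l then second_difference n x i l else 0))"
    by (intro sum.cong) (auto simp: second_difference_def)
  also have "\<dots> = - coord n x s (i + 1) + (\<Sum>l=Suc s..n + 1. second_difference n x i l)"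
  proof -
    have "(\<Sum>l=1..n + 1. if l = s then - coord n x s (i + 1) else 0) = - coord n x s (i + 1)"
      using coord_zero[OF tri s, of "i + 1"] s by (simp add: sum.delta del: sum.cl_ivl_Suc)
    moreover have "(\<Sum>l=1..n + 1. if s < l then second_difference n x i l else 0) =
        (\<Sum>l=Suc s..n + 1. second_difference n x i l)"
      by (rule sum.mono_neutral_cong_right) auto
    ultimately show ?thesis by (simp only: sum.distrib)
  qed
  finally show ?thesis
    using iota_index[OF s i] i by (simp add: sigma_def pairing_def coord_index)
qed

lemma sigma_zero_eq:
  assumes "triangular n x" "i \<in> {1..n}"
  shows "sigma_zero n lam i x = - lam i + (\<Sum>l=1..n + 1. second_difference n x i l)"
  using root_sum_eq[OF assms] by (simp add: sigma_zero_def pairing_def)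

lemma Sigma_wt_eq:
  assumes tri: "triangular n x"
  shows "Sigma_wt n lam x k = (if k \<in> {1..n} then - sigma_zero n lam k x else 0)"
proof (cases "k \<in> {1..n}")
  case True
  then show ?thesis
    unfolding sigma_zero_eq[OF tri True] root_sum_eq[OF tri True, symmetric]
    by (simp add: Sigma_wt_def mult.commute)
next
  case False
  have "alpha n (iota n p) k = 0" for p
  proof -
    have "iota n p \<in> {1..n}" using n by (simp add: iota_def Suc_le_eq)
    then show ?thesis using False by (simp only: alpha_apply if_False)
  qed
  moreover have "lam k = 0"
    using False lam unfolding dominant_weights_def weight_lattice_def by blast
  ultimately show ?thesis using False by (simp only: Sigma_wt_def if_False) simp
qed

lemma pattern_row_antimono:
  assumes x: "x \<in> Sigma_set n lam" and i: "i \<in> {1..n + 1}" and rs: "1 \<le> r" "r < s"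
  shows "pattern n lam x i s \<le> pattern n lam x (i + 1) r"
  using Suc_leI[OF rs(2)]
proof (induction rule: dec_induct)
  case base
  then show ?case using pattern_interlacing(2)[OF lam n x i rs(1)] by simp
next
  case (step m)
  have m: "1 \<le> m" using step rs by simp
  have "pattern n lam x i (Suc m) \<le> pattern n lam x (i + 1) m"
    using pattern_interlacing(2)[OF lam n x i m] by simp
  also have "\<dots> \<le> pattern n lam x i m" using pattern_interlacing(1)[OF lam n x i m] .
  finally show ?case using step by simp
qed

lemma psi_eq_iff:
  assumes x: "x \<in> Sigma_set n lam" and v: "v \<in> {1..n + 1}" and rc: "1 \<le> r" "1 \<le> c"
  shows "psi n lam x (r, c) = v \<longleftrightarrow>
    pattern n lam x (v + 1) r < int c \<and> int c \<le> pattern n lam x v r"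
proof -
  note enc = psi_encodes[OF lam n x]
  have "v \<le> psi n lam x (r, c) \<longleftrightarrow> int c \<le> pattern n lam x v r"
    using encodesD(2)[OF enc _ rc, of v] v by simp
  moreover have "v + 1 \<le> psi n lam x (r, c) \<longleftrightarrow> int c \<le> pattern n lam x (v + 1) r"
    using encodesD(2)[OF enc _ rc, of "v + 1"] v by simp
  ultimately show ?thesis by linarith
qed

text \<open>
  In row \<open>r\<close> the entries \<open>v\<close> fill the columns from \<open>g\<^sub>v\<^sub>+\<^sub>1(r) + 1\<close> to \<open>g\<^sub>v(r)\<close>. Sets \<open>S\<close> that contain
  all entries \<open>v\<close> of the rows from \<open>s\<close> on and none of the rows before therefore have an explicit
  count.
\<close>

lemma card_strip:
  assumes x: "x \<in> Sigma_set n lam" and v: "v \<in> {1..n + 1}" and s: "1 \<le> s"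
    and S: "S \<subseteq> young n lam"
    and mem: "\<And>r c. 1 \<le> r \<Longrightarrow> 1 \<le> c \<Longrightarrow> pattern n lam x (v + 1) r < int c \<Longrightarrow>
      int c \<le> pattern n lam x v r \<Longrightarrow> (r, c) \<in> young n lam \<Longrightarrow> (r, c) \<in> S \<longleftrightarrow> s \<le> r"
  shows "int (card {b \<in> S. psi n lam x b = v}) =
    (\<Sum>r=s..n + 1. pattern n lam x v r - pattern n lam x (v + 1) r)"
proof -
  let ?g = "pattern n lam x"
  let ?B = "\<lambda>r. {nat (?g (v + 1) r)<..nat (?g v r)}"
  have tri: "triangular n x" using triangular_if_Sigma[OF lam n x] .
  have nonneg: "0 \<le> ?g (v + 1) r" if "1 \<le> r" for r
    using pattern_nonneg[OF lam n x that, of "v + 1"] v by simp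
  have in_young: "(r, c) \<in> young n lam" if "1 \<le> r" "1 \<le> c" "int c \<le> ?g v r" for r c
  proof -
    have "?g v r \<le> ?g 1 r" using pattern_antimono[OF lam n x that(1), of 1 v] v by simp
    then show ?thesis using that young_iff[OF lam] pattern_top[OF lam n, of x r] by simp
  qed
  have "(r, c) \<in> {b \<in> S. psi n lam x b = v} \<longleftrightarrow> (r, c) \<in> (SIGMA r:{s..n + 1}. ?B r)" for r c
  proof (cases "1 \<le> r \<and> 1 \<le> c")
    case True
    then have rc: "1 \<le> r" "1 \<le> c" by auto
    have "r \<le> n + 1" if "int c \<le> ?g v r"
      using that pattern_beyond[OF lam n tri rc(1), of v] v rc by (cases "n < r") auto
    then show ?thesis
      using psi_eq_iff[OF x v rc] mem[OF rc] in_young[OF rc] nonneg[OF rc(1)] by auto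
  next
    case False
    then have "(r, c) \<notin> S" using S young_iff[OF lam] by blast
    moreover have "(r, c) \<notin> (SIGMA r:{s..n + 1}. ?B r)" using False s by auto
    ultimately show ?thesis by blast
  qed
  then have "{b \<in> S. psi n lam x b = v} = (SIGMA r:{s..n + 1}. ?B r)"
    by (intro set_eqI) (simp only: split_paired_all)
  then have "int (card {b \<in> S. psi n lam x b = v}) = (\<Sum>r=s..n + 1. int (card (?B r)))"
    by (simp del: sum.cl_ivl_Suc)
  also have "\<dots> = (\<Sum>r=s..n + 1. ?g v r - ?g (v + 1) r)"
  proof (rule sum.cong)
    fix r assume "r \<in> {s..n + 1}"
    then have r: "1 \<le> r" using s by simp
    then show "int (card (?B r)) = ?g v r - ?g (v + 1) r"
      using nonneg[OF r] pattern_interlacing(1)[OF lam n x v r] by simp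
  qed simp
  finally show ?thesis .
qed

text \<open>
  The contribution of \<open>\<lambda>\<close> is a difference of consecutive values, so it telescopes when summed over
  the rows.
\<close>

lemma pattern_second_difference:
  assumes "1 \<le> i" "1 \<le> r"
  shows "(pattern n lam x (i + 1) r - pattern n lam x (i + 2) r) -
      (pattern n lam x i r - pattern n lam x (i + 1) r) =
    second_difference n x i r +
      ((part n lam (r + i) - part n lam (r + i + 1)) - (part n lam (r - 1 + i) - part n lam (r - 1 + i + 1)))"
  using assms by (simp add: pattern_def second_difference_def)

lemma total_height_eq_sigma_zero:
  assumes x: "x \<in> Sigma_set n lam" and i: "i \<in> {1..n}"
  shows "total_height n lam i (psi n lam x) = sigma_zero n lam i x"
proof -
  let ?g = "pattern n lam x" and ?a = "\<lambda>r. part n lam (r + i) - part n lam (r + i + 1)"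
  have "total_height n lam i (psi n lam x) =
      (\<Sum>r=1..n + 1. ?g (i + 1) r - ?g (i + 2) r) - (\<Sum>r=1..n + 1. ?g i r - ?g (i + 1) r)"
    unfolding total_height_def sum_box_sign[OF finite_young[OF lam]]
    using card_strip[OF x, of "i + 1" 1 "young n lam"] card_strip[OF x, of i 1 "young n lam"] i
    by simp
  also have "\<dots> = (\<Sum>r=1..n + 1. second_difference n x i r + (?a r - ?a (r - 1)))"
    unfolding sum_subtractf[symmetric]
    by (intro sum.cong pattern_second_difference) (use i in auto)
  also have "\<dots> = (\<Sum>r=1..n + 1. second_difference n x i r) + (?a (n + 1) - ?a 0)"
    using sum_telescope''[of 0 "n + 1" ?a] by (simp only: sum.distrib One_nat_def)
  finally show ?thesis
    using sigma_zero_eq[OF triangular_if_Sigma[OF lam n x] i] part_diff[OF i, of lam]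
    by (simp add: part_beyond)
qed

text \<open>
  Interlacing makes the final segment opened by \<open>row_end\<close> contain precisely the entries \<open>i + 1\<close> in the
  rows from \<open>s\<close> on and the entries \<open>i\<close> in the rows after \<open>s\<close>. Counting them row by row gives
  \<open>\<sigma>\<^sub>k\<close>, as the contributions of \<open>\<lambda>\<close> telescope to \<open>0\<close>.
\<close>

lemma sigma_eq_height:
  assumes x: "x \<in> Sigma_set n lam" and i: "i \<in> {1..n}" and s: "1 \<le> s"
  shows "sigma n x ((s - 1) * n + i) = height n lam i (psi n lam x) (row_end n lam x i s)"
proof -
  let ?g = "pattern n lam x" and ?a = "\<lambda>r. part n lam (r + i) - part n lam (r + i + 1)"
  let ?S = "tail_of n lam (row_end n lam x i s)"
  have tri: "triangular n x" using triangular_if_Sigma[OF lam n x] .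
  note anti = pattern_row_antimono[OF x]
  have i': "i \<in> {1..n + 1}" "i + 1 \<in> {1..n + 1}" using i by auto
  have nonneg: "0 \<le> ?g (i + 1) s" using pattern_nonneg[OF lam n x s, of "i + 1"] i by simp
  have mem: "(r, c) \<in> ?S \<longleftrightarrow> int c < ?g (i + 1) s \<or> int c = ?g (i + 1) s \<and> s \<le> r"
    if "(r, c) \<in> young n lam" for r c
    using that nonneg young_iff[OF lam, of r c] by (auto simp: tail_of_def later_def row_end_def)
  have shrink: "?g (i + 2) r \<le> ?g (i + 1) r" "?g (i + 1) r \<le> ?g i r" if "1 \<le> r" for r
    using pattern_interlacing(1)[OF lam n x _ that] i' by auto
  have plus: "int (card {b \<in> ?S. psi n lam x b = i + 1}) =
      (\<Sum>r=s..n + 1. ?g (i + 1) r - ?g (i + 2) r)"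
  proof -
    have "(r, c) \<in> ?S \<longleftrightarrow> s \<le> r" if rc: "1 \<le> r" "?g (i + 2) r < int c" "int c \<le> ?g (i + 1) r"
      and Y: "(r, c) \<in> young n lam" for r c
    proof (cases "r < s")
      case True
      then show ?thesis using anti[OF i'(2) rc(1) True] mem[OF Y] rc by simp
    next
      case False
      then have "?g (i + 1) r \<le> ?g (i + 1) s"
        using anti[OF i'(2) s, of r] shrink(1)[OF s] by (cases "r = s") auto
      then show ?thesis using mem[OF Y] rc False by auto
    qed
    then show ?thesis
      using card_strip[OF x i'(2) s, of ?S] by (simp add: tail_of_def del: sum.cl_ivl_Suc)
  qed
  have minus: "int (card {b \<in> ?S. psi n lam x b = i}) =
      (\<Sum>r=Suc s..n + 1. ?g i r - ?g (i + 1) r)"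
  proof -
    have "(r, c) \<in> ?S \<longleftrightarrow> Suc s \<le> r" if rc: "1 \<le> r" "?g (i + 1) r < int c" "int c \<le> ?g i r"
      and Y: "(r, c) \<in> young n lam" for r c
    proof (cases "s < r")
      case True
      then show ?thesis using anti[OF i'(1) s True] mem[OF Y] rc by auto
    next
      case False
      then have "?g (i + 1) s \<le> ?g (i + 1) r"
        using anti[OF i'(2) rc(1), of s] shrink(1)[OF rc(1)] by (cases "r = s") auto
      then show ?thesis using mem[OF Y] rc False by auto
    qed
    then show ?thesis
      using card_strip[OF x i'(1), of "Suc s" ?S] by (simp add: tail_of_def del: sum.cl_ivl_Suc)
  qed
  have height: "height n lam i (psi n lam x) (row_end n lam x i s) =
      (\<Sum>r=s..n + 1. ?g (i + 1) r - ?g (i + 2) r) - (\<Sum>r=Suc s..n + 1. ?g i r - ?g (i + 1) r)"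
    unfolding height_def sum_box_sign[OF finite_tail[OF lam]] plus minus ..
  show ?thesis
  proof (cases "s \<le> n + 1")
    case True
    have "height n lam i (psi n lam x) (row_end n lam x i s) = (?g (i + 1) s - ?g (i + 2) s) +
        (\<Sum>r=Suc s..n + 1. (?g (i + 1) r - ?g (i + 2) r) - (?g i r - ?g (i + 1) r))"
      unfolding height sum.atLeast_Suc_atMost[OF True]
        sum_subtractf[of "\<lambda>r. ?g (i + 1) r - ?g (i + 2) r" "\<lambda>r. ?g i r - ?g (i + 1) r"]
      by (rule add_diff_eq[symmetric])
    also have "(\<Sum>r=Suc s..n + 1. (?g (i + 1) r - ?g (i + 2) r) - (?g i r - ?g (i + 1) r)) =
        (\<Sum>r=Suc s..n + 1. second_difference n x i r + (?a r - ?a (r - 1)))"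
      by (intro sum.cong pattern_second_difference) (use i in auto)
    also have "\<dots> = (\<Sum>r=Suc s..n + 1. second_difference n x i r) + (?a (n + 1) - ?a s)"
      using sum_telescope''[OF True, of ?a] by (simp only: sum.distrib)
    finally show ?thesis
      using sigma_eq[OF tri i s] s i by (simp add: part_beyond pattern_def)
  next
    case False
    then show ?thesis
      using height sigma_eq[OF tri i s] coord_zero[OF tri s, of i] coord_zero[OF tri s, of "i + 1"]
      by simp
  qed
qed

end

section \<open>The isomorphism\<close>

lemma mem_positions_iff:
  assumes "1 \<le> n" "i \<in> {1..n}"
  shows "k \<in> positions n i \<longleftrightarrow> (\<exists>s\<ge>1. k = (s - 1) * n + i)"
proof
  assume k: "k \<in> positions n i"
  then obtain l m where lm: "1 \<le> l" "m \<in> {1..n}" "k = (l - 1) * n + m"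
    using index_cases[of k n] assms(1) by (auto simp: positions_def)
  then have "m = i" using k iota_index[OF lm(1,2)] by (simp add: positions_def)
  then show "\<exists>s\<ge>1. k = (s - 1) * n + i" using lm by blast
next
  assume "\<exists>s\<ge>1. k = (s - 1) * n + i"
  then show "k \<in> positions n i"
    using assms(2) iota_index by (auto simp: positions_def)
qed

text \<open>
  The crystal axioms are required of both sides, but those of the source follow from those of
  the target by transport along the bijection.
\<close>

lemma crystal_isoI:
  assumes B2: "is_crystal n B2" and bij: "bij_betw h (elts B1) (elts B2)"
    and wt_eq: "\<And>b. b \<in> elts B1 \<Longrightarrow> wt B2 (h b) = wt B1 b"
    and eps_eq: "\<And>i b. i \<in> {1..n} \<Longrightarrow> b \<in> elts B1 \<Longrightarrow> eps B2 i (h b) = eps B1 i b"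
    and phi_eq: "\<And>i b. i \<in> {1..n} \<Longrightarrow> b \<in> elts B1 \<Longrightarrow> phi B2 i (h b) = phi B1 i b"
    and et_in: "\<And>i b. i \<in> {1..n} \<Longrightarrow> b \<in> elts B1 \<Longrightarrow> et B1 i b \<in> with_zero B1"
    and ft_in: "\<And>i b. i \<in> {1..n} \<Longrightarrow> b \<in> elts B1 \<Longrightarrow> ft B1 i b \<in> with_zero B1"
    and et_eq: "\<And>i b. i \<in> {1..n} \<Longrightarrow> b \<in> elts B1 \<Longrightarrow> map_option h (et B1 i b) = et B2 i (h b)"
    and ft_eq: "\<And>i b. i \<in> {1..n} \<Longrightarrow> b \<in> elts B1 \<Longrightarrow> map_option h (ft B1 i b) = ft B2 i (h b)"
  shows "crystal_iso n B1 B2 (map_option h)"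
proof -
  have h_in: "h b \<in> elts B2" if "b \<in> elts B1" for b using bij that by (auto simp: bij_betw_def)
  have inj: "h b = h b' \<longleftrightarrow> b = b'" if "b \<in> elts B1" "b' \<in> elts B1" for b b'
    using bij that by (auto simp: bij_betw_def dest: inj_onD)
  have et_iff: "et B1 i b = Some b' \<longleftrightarrow> et B2 i (h b) = Some (h b')"
    if "i \<in> {1..n}" "b \<in> elts B1" "b' \<in> elts B1" for i b b'
    using et_eq[OF that(1,2), symmetric] et_in[OF that(1,2)] inj that(3)
    by (cases "et B1 i b") (auto simp: with_zero_def)
  have ft_iff: "ft B1 i b = Some b' \<longleftrightarrow> ft B2 i (h b) = Some (h b')"
    if "i \<in> {1..n}" "b \<in> elts B1" "b' \<in> elts B1" for i b b'
    using ft_eq[OF that(1,2), symmetric] ft_in[OF that(1,2)] inj that(3)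
    by (cases "ft B1 i b") (auto simp: with_zero_def)
  have "is_crystal n B1"
    unfolding is_crystal_def
  proof (intro conjI ballI allI impI)
    fix b assume b: "b \<in> elts B1"
    note hb = h_in[OF b]
    have "wt B2 (h b) \<in> weight_lattice n" using B2 hb unfolding is_crystal_def by blast
    then show "wt B1 b \<in> weight_lattice n" unfolding wt_eq[OF b] .
    fix i assume i: "i \<in> {1..n}"
    note eq = wt_eq[OF b] eps_eq[OF i b] phi_eq[OF i b]
    show "et B1 i b \<in> with_zero B1" "ft B1 i b \<in> with_zero B1"
      using et_in[OF i b] ft_in[OF i b] .
    have "phi B2 i (h b) = shift (eps B2 i (h b)) (pairing i (wt B2 (h b)))"
      using B2 hb i unfolding is_crystal_def by blast
    then show "phi B1 i b = shift (eps B1 i b) (pairing i (wt B1 b))" unfolding eq .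
    {
      fix b' assume e: "et B1 i b = Some b'"
      then have b': "b' \<in> elts B1" using et_in[OF i b] by (auto simp: with_zero_def)
      note eq' = wt_eq[OF b'] eps_eq[OF i b'] phi_eq[OF i b']
      have "et B2 i (h b) = Some (h b')" using et_iff[OF i b b'] e by simp
      then have "wt B2 (h b') = (\<lambda>k. wt B2 (h b) k + alpha n i k) \<and>
          eps B2 i (h b') = shift (eps B2 i (h b)) (- 1) \<and>
          phi B2 i (h b') = shift (phi B2 i (h b)) 1"
        using B2 hb i unfolding is_crystal_def by blast
      then show "wt B1 b' = (\<lambda>k. wt B1 b k + alpha n i k)"
        "eps B1 i b' = shift (eps B1 i b) (- 1)" "phi B1 i b' = shift (phi B1 i b) 1"
        unfolding eq eq' by blast+
    }
    {
      fix b' assume f: "ft B1 i b = Some b'"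
      then have b': "b' \<in> elts B1" using ft_in[OF i b] by (auto simp: with_zero_def)
      note eq' = wt_eq[OF b'] eps_eq[OF i b'] phi_eq[OF i b']
      have "ft B2 i (h b) = Some (h b')" using ft_iff[OF i b b'] f by simp
      then have "wt B2 (h b') = (\<lambda>k. wt B2 (h b) k - alpha n i k) \<and>
          eps B2 i (h b') = shift (eps B2 i (h b)) 1 \<and>
          phi B2 i (h b') = shift (phi B2 i (h b)) (- 1)"
        using B2 hb i unfolding is_crystal_def by blast
      then show "wt B1 b' = (\<lambda>k. wt B1 b k - alpha n i k)"
        "eps B1 i b' = shift (eps B1 i b) 1" "phi B1 i b' = shift (phi B1 i b) (- 1)"
        unfolding eq eq' by blast+
    }
    show "ft B1 i b = Some b' \<longleftrightarrow> et B1 i b' = Some b" if b': "b' \<in> elts B1" for b'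
    proof -
      have "ft B2 i (h b) = Some (h b') \<longleftrightarrow> et B2 i (h b') = Some (h b)"
        using B2 hb h_in[OF b'] i unfolding is_crystal_def by blast
      then show ?thesis using ft_iff[OF i b b'] et_iff[OF i b' b] by simp
    qed
    assume "phi B1 i b = MInf"
    then have "et B2 i (h b) = None \<and> ft B2 i (h b) = None"
      using B2 hb i eq unfolding is_crystal_def by metis
    then show "et B1 i b = None" "ft B1 i b = None"
      using et_eq[OF i b] ft_eq[OF i b] by simp_all
  qed
  moreover have "bij_betw (map_option h) (with_zero B1) (with_zero B2)"
  proof -
    have "inj_on (map_option h) (with_zero B1)"
      using inj by (auto simp: with_zero_def inj_on_def)
    moreover have "map_option h ` with_zero B1 = insert None (Some ` h ` elts B1)"
      unfolding with_zero_def by (simp add: image_image)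
    then have "map_option h ` with_zero B1 = with_zero B2"
      using bij by (simp add: with_zero_def bij_betw_def)
    ultimately show ?thesis by (simp add: bij_betw_def)
  qed
  ultimately show ?thesis
    using B2 wt_eq eps_eq phi_eq et_eq ft_eq
    by (auto simp: crystal_iso_def with_zero_def)
qed

context
  fixes n :: nat and lam :: weight
  assumes lam: "lam \<in> dominant_weights n" and n: "1 \<le> n"
begin

text \<open>
  The box changed by \<open>e\<^sub>i\<close> must be the last entry \<open>i + 1\<close> of its row, as the result is a reverse tableau.
\<close>

lemma e_step_at_row_end:
  assumes x: "x \<in> Sigma_set n lam" and i: "i \<in> {1..n}"
    and up: "e_step n lam i (psi n lam x) b T'"
  shows "\<exists>s c. 1 \<le> s \<and> 1 \<le> c \<and> b = (s, c) \<and> int c = pattern n lam x (i + 1) s"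
proof -
  obtain s c where b: "b = (s, c)" by (cases b)
  have Tb: "psi n lam x (s, c) = i + 1" "T' = (psi n lam x)((s, c) := i)" "(s, c) \<in> young n lam"
    using up by (auto simp: e_step_def b)
  have sc: "1 \<le> s" "1 \<le> c" using Tb(3) young_iff[OF lam] by auto
  have T': "T' \<in> reverse_ssyt n lam" using e_step_in[OF lam psi_in_reverse[OF lam n x] i up] .
  have "psi n lam x (s, c + 1) \<le> i" using row_step[OF lam T' sc] Tb(2) by simp
  then have "pattern n lam x (i + 1) s < int c + 1"
    using encodesD(2)[OF psi_encodes[OF lam n x] _ sc(1), of "i + 1" "c + 1"] i by auto
  moreover have "int c \<le> pattern n lam x (i + 1) s"
    using psi_eq_iff[OF lam n x _ sc, of "i + 1"] Tb(1) i by simp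
  ultimately show ?thesis using sc b by force
qed

text \<open>
  The box changed by \<open>f\<^sub>i\<close> is the first entry \<open>i\<close> of its row. The segment after it and the segment
  opened by \<open>row_end\<close>, its left neighbour, have the same height: the entries that separate them are
  \<open>< i\<close> below the box and \<open>> i + 1\<close> above the neighbour.
\<close>

lemma f_step_after_row_end:
  assumes x: "x \<in> Sigma_set n lam" and i: "i \<in> {1..n}"
    and low: "f_step n lam i (psi n lam x) b T'"
  shows "\<exists>s c. 1 \<le> s \<and> 1 \<le> c \<and> b = (s, c) \<and> int c = pattern n lam x (i + 1) s + 1 \<and>
    height n lam i (psi n lam x) (next_box b) =
      height n lam i (psi n lam x) (row_end n lam x i s)"
proof -
  let ?T = "psi n lam x"
  have i1: "1 \<le> i" using i by simp
  obtain s c where b: "b = (s, c)" by (cases b)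
  have Tb: "?T (s, c) = i" "T' = ?T((s, c) := i + 1)" "(s, c) \<in> young n lam"
    using low by (auto simp: f_step_def b)
  have sc: "1 \<le> s" "1 \<le> c" using Tb(3) young_iff[OF lam] by auto
  have T: "?T \<in> reverse_ssyt n lam" using psi_in_reverse[OF lam n x] .
  have T': "T' \<in> reverse_ssyt n lam" using f_step_in[OF lam T i low] .
  note enc = encodesD[OF psi_encodes[OF lam n x] _ sc(1), of "i + 1"]
  have "pattern n lam x (i + 1) s < int c"
    using psi_eq_iff[OF lam n x _ sc, of i] Tb(1) i by simp
  moreover have left: "i + 1 \<le> ?T (s, c - 1)" if "c \<noteq> 1"
  proof -
    have "c - 1 + 1 = c" "c - 1 \<noteq> c" "1 \<le> c - 1" using sc that by arith+
    then show ?thesis using row_step[OF lam T' sc(1), of "c - 1"] Tb(2) by simp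
  qed
  then have "int c - 1 \<le> pattern n lam x (i + 1) s"
    using enc(2)[of "c - 1"] enc(1) i sc by (cases "c = 1") auto
  ultimately have c: "int c = pattern n lam x (i + 1) s + 1" by simp
  then have row_end: "row_end n lam x i s = (s, c - 1)" by (simp add: row_end_def)
  have "height n lam i ?T (s + 1, c) = height n lam i ?T (s + 1 + n, c)"
    using box_sign_below[OF lam T i1 sc] Tb(1) by (intro height_skip[OF lam T i1]) auto
  also have "\<dots> = height n lam i ?T (0, c - 1)"
    using height_column_end[OF lam, of "s + 1 + n" i ?T "c - 1"] sc by simp
  also have "\<dots> = height n lam i ?T (s, c - 1)"
  proof (rule height_skip[OF lam T i1])
    show "box_sign i ?T (k, c - 1) = 0" if "k < s" for k
    proof (cases "c = 1")
      case True
      then show ?thesis using outside[OF lam T, of "(k, 0)"] young_iff[OF lam, of k 0] i1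
        by (simp add: box_sign_def)
    next
      case False
      then show ?thesis using box_sign_above[OF lam T i1 _ that, of "c - 1"] left sc by simp
    qed
  qed simp
  finally show ?thesis using sc b c row_end by (auto simp: next_box_def)
qed

text \<open>
  Changing \<open>x\<^sub>s\<^sup>(\<^sup>i\<^sup>)\<close> by one changes only the number of entries \<open>\<ge> i + 1\<close> in row \<open>s\<close>, and the single
  box affected is \<open>(s, c)\<close>.
\<close>

lemma psi_update:
  assumes x: "x \<in> Sigma_set n lam" and i: "i \<in> {1..n}" and sc: "1 \<le> s" "1 \<le> c"
    and T': "(psi n lam x)((s, c) := v) \<in> reverse_ssyt n lam"
    and change: "psi n lam x (s, c) = i \<and> v = i + 1 \<and> d = 1 \<and> int c = pattern n lam x (i + 1) s + 1 \<or>
      psi n lam x (s, c) = i + 1 \<and> v = i \<and> d = - 1 \<and> int c = pattern n lam x (i + 1) s"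
  defines "k \<equiv> (s - 1) * n + i"
  shows "x(k := x k + d) \<in> Sigma_set n lam \<and>
    psi n lam (x(k := x k + d)) = (psi n lam x)((s, c) := v)"
proof (rule psi_eqI[OF lam n _ T'])
  let ?T = "psi n lam x" and ?x' = "x(k := x k + d)"
  have tri: "triangular n x" using triangular_if_Sigma[OF lam n x] .
  have i_s: "i + s \<le> n + 1"
    using change entry_plus_row_le[OF lam psi_in_reverse[OF lam n x] sc]
      entry_plus_row_le[OF lam T' sc] by auto
  have index: "(r - 1) * n + m = k \<longleftrightarrow> r = s \<and> m = i" if "1 \<le> r" "m \<in> {1..n}" for r m
    using index_eq_iff[of m n i r s] that i sc(1) by (auto simp: k_def)
  show "triangular n ?x'"
  proof -
    have "{p. ?x' p \<noteq> 0} \<subseteq> insert k {p. x p \<noteq> 0}" by auto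
    moreover have "finite (insert k {p. x p \<noteq> 0})"
      using tri by (simp add: triangular_def sequences_def)
    ultimately have "finite {p. ?x' p \<noteq> 0}" by (rule finite_subset)
    moreover have "?x' 0 = 0" using tri i by (simp add: triangular_def sequences_def k_def)
    moreover have "xc n ?x' j m = 0" if "m \<in> {1..n}" "1 \<le> j" "n + 1 < m + j" for j m
      using tri index[OF that(2,1)] i_s that by (auto simp: triangular_def xc_def)
    ultimately show ?thesis by (simp add: triangular_def sequences_def)
  qed
  have pattern': "pattern n lam ?x' j r = pattern n lam x j r + (if j = i + 1 \<and> r = s then d else 0)"
    if "1 \<le> j" "1 \<le> r" for j r
  proof (cases "j - 1 \<in> {1..n}")
    case True
    then show ?thesis using index[OF that(2) True] that by (auto simp: pattern_def coord_index)
  next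
    case False
    then have "coord n y r (j - 1) = 0" for y by (cases "j - 1 = 0") auto
    moreover have "j \<noteq> i + 1" using False i by auto
    ultimately show ?thesis by (simp add: pattern_def)
  qed
  note enc = encodesD[OF psi_encodes[OF lam n x]]
  show "encodes n (?T((s, c) := v)) (pattern n lam ?x')"
    unfolding encodes_def
  proof (intro ballI allI impI conjI)
    fix j r assume j: "j \<in> {1..n + 2}" and r: "1 \<le> (r::nat)"
    then have j1: "1 \<le> j" by simp
    show "0 \<le> pattern n lam ?x' j r"
      using enc(1)[OF j r] pattern'[OF j1 r] change sc(2) by auto
    fix c' :: nat assume c': "1 \<le> c'"
    show "j \<le> (?T((s, c) := v)) (r, c') \<longleftrightarrow> int c' \<le> pattern n lam ?x' j r"
      using enc(2)[OF j r c'] pattern'[OF j1 r] change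
      by (cases "r = s"; cases "c' = c"; cases "j = i + 1") auto
  qed
qed

text \<open>
  The values \<open>\<sigma>\<^sub>k\<close> are some of the heights. They include the largest one: if it is positive,
  \<open>e\<^sub>i\<close> acts and the box changed by it is a \<open>row_end\<close>; if it is \<open>0\<close>, it is the value of \<open>\<sigma>\<^sub>k\<close> beyond
  the support of \<open>x\<close>.
\<close>

lemma sigma_max_eq:
  assumes x: "x \<in> Sigma_set n lam" and i: "i \<in> {1..n}"
  shows "sigma_max n i x = top_height n lam i (psi n lam x)"
  unfolding sigma_max_def
proof (rule Max_eqI)
  let ?T = "psi n lam x"
  note pos = mem_positions_iff[OF n i]
  note sig = sigma_eq_height[OF lam n x i]
  have "sigma n x ` positions n i \<subseteq> range (height n lam i ?T)" using pos sig by auto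
  then show "finite (sigma n x ` positions n i)"
    using finite_range_height[OF lam] finite_subset by blast
  show "y \<le> top_height n lam i ?T" if y: "y \<in> sigma n x ` positions n i" for y
  proof -
    obtain k where k: "k \<in> positions n i" "y = sigma n x k" using y by blast
    then obtain s where "1 \<le> s" "k = (s - 1) * n + i" using pos[of k] by blast
    then show ?thesis using sig[of s] height_le_top[OF lam, of i ?T "row_end n lam x i s"] k(2) by simp
  qed
  have T: "?T \<in> reverse_ssyt n lam" using psi_in_reverse[OF lam n x] .
  have "\<exists>s\<ge>1. sigma n x ((s - 1) * n + i) = top_height n lam i ?T"
  proof (cases "et (reverse_ssyt_crystal n lam) i ?T")
    case None
    then have top: "top_height n lam i ?T = 0" using reverse_crystal_operators(6)[OF lam T i] by simp
    have tri: "triangular n x" using triangular_if_Sigma[OF lam n x] .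
    \<comment> \<open>Block \<open>n + 2\<close> lies beyond the support of \<open>x\<close>.\<close>
    have "sigma n x ((n + 2 - 1) * n + i) = 0"
      using sigma_eq[OF lam n tri i, of "n + 2"] coord_zero[OF tri, of "n + 2"] by simp
    then show ?thesis using top by (intro exI[of _ "n + 2"]) simp
  next
    case (Some T')
    then obtain b where up: "e_step n lam i ?T b T'"
      using reverse_crystal_operators(4)[OF lam T i] by blast
    then obtain s c where s: "1 \<le> s" "b = (s, c)" "int c = pattern n lam x (i + 1) s"
      using e_step_at_row_end[OF x i] by blast
    have "b = row_end n lam x i s" unfolding row_end_def s(2) s(3)[symmetric] by simp
    then show ?thesis using s(1) sig[OF s(1)] e_step_top[OF lam up] by auto
  qed
  then obtain s where s: "1 \<le> s" "sigma n x ((s - 1) * n + i) = top_height n lam i ?T" by blast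
  then have "(s - 1) * n + i \<in> positions n i" unfolding pos by blast
  then show "top_height n lam i ?T \<in> sigma n x ` positions n i" unfolding s(2)[symmetric] by (rule imageI)
qed

lemma mem_sigma_argmax_iff:
  assumes x: "x \<in> Sigma_set n lam" and i: "i \<in> {1..n}"
  shows "k \<in> sigma_argmax n i x \<longleftrightarrow> (\<exists>s\<ge>1. k = (s - 1) * n + i \<and>
    height n lam i (psi n lam x) (row_end n lam x i s) = top_height n lam i (psi n lam x))"
  unfolding sigma_argmax_def sigma_max_eq[OF x i] mem_Collect_eq mem_positions_iff[OF n i]
proof (intro iffI; elim exE conjE)
  fix s assume s: "1 \<le> s" "k = (s - 1) * n + i"
  note sig = sigma_eq_height[OF lam n x i s(1), folded s(2)]
  show "\<exists>s\<ge>1. k = (s - 1) * n + i \<and>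
      height n lam i (psi n lam x) (row_end n lam x i s) = top_height n lam i (psi n lam x)"
    if "sigma n x k = top_height n lam i (psi n lam x)"
    using that s unfolding sig by blast
  show "(\<exists>s\<ge>1. k = (s - 1) * n + i) \<and> sigma n x k = top_height n lam i (psi n lam x)"
    if "height n lam i (psi n lam x) (row_end n lam x i s) = top_height n lam i (psi n lam x)"
    using that s unfolding sig by blast
qed

text \<open>
  A maximising position \<open>k\<close> beyond row \<open>s\<close> would name a shorter final segment of maximal height than
  the one opened by the box that \<open>e\<^sub>i\<close> changes.
\<close>

lemma Sigma_e_commutes:
  assumes x: "x \<in> Sigma_set n lam" and i: "i \<in> {1..n}"
  shows "Sigma_e n lam i x \<in> insert None (Some ` Sigma_set n lam) \<and>
    map_option (psi n lam) (Sigma_e n lam i x) = et (reverse_ssyt_crystal n lam) i (psi n lam x)"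
proof -
  let ?T = "psi n lam x"
  have T: "?T \<in> reverse_ssyt n lam" using psi_in_reverse[OF lam n x] .
  note ops = reverse_crystal_operators[OF lam T i]
  show ?thesis
  proof (cases "et (reverse_ssyt_crystal n lam) i ?T")
    case None
    then have "sigma_max n i x = 0" using ops(6) sigma_max_eq[OF x i] by simp
    then show ?thesis using None by (simp add: Sigma_e_def)
  next
    case (Some T')
    then obtain b where up: "e_step n lam i ?T b T'" using ops(4) by blast
    then obtain s c where sc: "1 \<le> s" "1 \<le> c" "b = (s, c)" "int c = pattern n lam x (i + 1) s"
      using e_step_at_row_end[OF x i] by blast
    have b: "b = row_end n lam x i s" unfolding row_end_def sc(3) sc(4)[symmetric] by simp
    define k where "k = (s - 1) * n + i"
    have "Max (sigma_argmax n i x) = k"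
    proof -
      have le: "k' \<le> k" if k': "k' \<in> sigma_argmax n i x" for k'
      proof -
        obtain s' where s': "1 \<le> s'" "k' = (s' - 1) * n + i"
          and top: "height n lam i ?T (row_end n lam x i s') = top_height n lam i ?T"
          using k' mem_sigma_argmax_iff[OF x i] by blast
        have "s' \<le> s"
        proof (rule ccontr)
          assume "\<not> s' \<le> s"
          then have "s < s'" by simp
          have "pattern n lam x (i + 1) s' \<le> pattern n lam x (i + 2) s"
            using pattern_row_antimono[OF lam n x _ sc(1) \<open>s < s'\<close>, of "i + 1"] i by simp
          also have "\<dots> \<le> pattern n lam x (i + 1) s"
            using pattern_interlacing(1)[OF lam n x _ sc(1), of "i + 1"] i by simp
          finally have "later b (row_end n lam x i s')"
            using \<open>s < s'\<close> by (auto simp: b row_end_def later_def)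
          then show False using up top e_step_top[OF lam up] by (auto simp: e_step_def)
        qed
        then show ?thesis by (simp add: s'(2) k_def diff_le_mono)
      qed
      then have "finite (sigma_argmax n i x)"
        unfolding finite_nat_set_iff_bounded_le by blast
      moreover have "k \<in> sigma_argmax n i x"
        using mem_sigma_argmax_iff[OF x i] e_step_top[OF lam up] sc(1) b k_def by metis
      ultimately show ?thesis using le by (intro Max_eqI)
    qed
    moreover have "sigma_max n i x > 0" using top_positive[OF lam up] sigma_max_eq[OF x i] by simp
    moreover have "sigma_max n i x \<ge> sigma_zero n lam i x"
      unfolding sigma_max_eq[OF x i] total_height_eq_sigma_zero[OF lam n x i, symmetric]
      by (rule total_le_top[OF lam])
    ultimately have e: "Sigma_e n lam i x = Some (x(k := x k + - 1))"
      by (simp add: Sigma_e_def)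
    have T': "T' = ?T((s, c) := i)" "?T (s, c) = i + 1" using up sc(3) by (auto simp: e_step_def)
    have "?T((s, c) := i) \<in> reverse_ssyt n lam" using e_step_in[OF lam T i up] T'(1) by simp
    then have "x(k := x k + - 1) \<in> Sigma_set n lam \<and> psi n lam (x(k := x k + - 1)) = T'"
      unfolding k_def T'(1) using T'(2) sc(4)
      by (intro psi_update[OF x i sc(1,2)]) auto
    then show ?thesis unfolding e Some by simp
  qed
qed

text \<open>
  A maximising position \<open>k\<close> before row \<open>s\<close> would name a final segment of maximal height that
  contains the box changed by \<open>f\<^sub>i\<close>.
\<close>

lemma Sigma_f_commutes:
  assumes x: "x \<in> Sigma_set n lam" and i: "i \<in> {1..n}"
  shows "Sigma_f n lam i x \<in> insert None (Some ` Sigma_set n lam) \<and>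
    map_option (psi n lam) (Sigma_f n lam i x) = ft (reverse_ssyt_crystal n lam) i (psi n lam x)"
proof -
  let ?T = "psi n lam x"
  have T: "?T \<in> reverse_ssyt n lam" using psi_in_reverse[OF lam n x] .
  note ops = reverse_crystal_operators[OF lam T i]
  show ?thesis
  proof (cases "ft (reverse_ssyt_crystal n lam) i ?T")
    case None
    then have "sigma_max n i x = sigma_zero n lam i x"
      using ops(5) sigma_max_eq[OF x i] total_height_eq_sigma_zero[OF lam n x i] by simp
    then show ?thesis using None by (simp add: Sigma_f_def)
  next
    case (Some T')
    then obtain b where low: "f_step n lam i ?T b T'" using ops(3) by blast
    then obtain s c where sc: "1 \<le> s" "1 \<le> c" "b = (s, c)" "int c = pattern n lam x (i + 1) s + 1"
      and top: "height n lam i ?T (next_box b) = height n lam i ?T (row_end n lam x i s)"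
      using f_step_after_row_end[OF x i] by blast
    have T': "T' = ?T((s, c) := i + 1)" "?T (s, c) = i" using low sc(3) by (auto simp: f_step_def)
    define k where "k = (s - 1) * n + i"
    have "(LEAST k. k \<in> sigma_argmax n i x) = k"
    proof (rule Least_equality)
      show "k \<in> sigma_argmax n i x"
        using mem_sigma_argmax_iff[OF x i] f_step_top[OF lam low] top sc(1) k_def by metis
      fix k' assume k': "k' \<in> sigma_argmax n i x"
      then obtain s' where s': "1 \<le> s'" "k' = (s' - 1) * n + i"
        and top': "height n lam i ?T (row_end n lam x i s') = top_height n lam i ?T"
        using mem_sigma_argmax_iff[OF x i] by blast
      have "s \<le> s'"
      proof (rule ccontr)
        assume "\<not> s \<le> s'"
        then have "s' < s" by simp
        have "int c \<le> pattern n lam x i s" using psi_eq_iff[OF lam n x _ sc(1,2), of i] T'(2) i by simp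
        also have "\<dots> \<le> pattern n lam x (i + 1) s'"
          using pattern_row_antimono[OF lam n x _ s'(1) \<open>s' < s\<close>, of i] i by simp
        finally have "\<not> later b (row_end n lam x i s')"
          using \<open>s' < s\<close> by (auto simp: sc(3) row_end_def later_def)
        then show False using low top' f_step_top[OF lam low] by (auto simp: f_step_def)
      qed
      then show "k \<le> k'" by (simp add: s'(2) k_def diff_le_mono)
    qed
    moreover have "sigma_max n i x > sigma_zero n lam i x"
      using total_less_top[OF lam low] sigma_max_eq[OF x i]
        total_height_eq_sigma_zero[OF lam n x i] by simp
    ultimately have f: "Sigma_f n lam i x = Some (x(k := x k + 1))"
      by (simp add: Sigma_f_def)
    have "?T((s, c) := i + 1) \<in> reverse_ssyt n lam" using f_step_in[OF lam T i low] T'(1) by simp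
    then have "x(k := x k + 1) \<in> Sigma_set n lam \<and> psi n lam (x(k := x k + 1)) = T'"
      unfolding k_def T'(1) using T'(2) sc(4)
      by (intro psi_update[OF x i sc(1,2)]) auto
    then show ?thesis unfolding f Some by simp
  qed
qed

end

theorem theorem3p9:
  fixes n :: nat and lam :: weight
  assumes "n \<ge> 1"
    and "lam \<in> dominant_weights n"
  shows "crystal_iso n (Sigma_crystal n lam) (reverse_ssyt_crystal n lam)
    (map_option (psi n lam))"
proof (rule crystal_isoI)
  note lam = assms(2) and n = assms(1)
  let ?S = "Sigma_crystal n lam" and ?C = "reverse_ssyt_crystal n lam"
  have Sigma_simps: "elts ?S = Sigma_set n lam" "wt ?S = Sigma_wt n lam" "et ?S = Sigma_e n lam"
    "ft ?S = Sigma_f n lam" "eps ?S = (\<lambda>i x. Fin (Sigma_eps n lam i x))"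
    "phi ?S = (\<lambda>i x. Fin (pairing i (Sigma_wt n lam x) + Sigma_eps n lam i x))"
    by (simp_all add: Sigma_crystal_def)
  show "is_crystal n ?C" using reverse_ssyt_is_crystal[OF lam] .
  show "bij_betw (psi n lam) (elts ?S) (elts ?C)"
    unfolding Sigma_simps reverse_crystal_simps[OF lam] using psi_bij[OF lam n] .
  fix x assume "x \<in> elts ?S"
  then have x: "x \<in> Sigma_set n lam" by (simp add: Sigma_simps)
  have tri: "triangular n x" using triangular_if_Sigma[OF lam n x] .
  have T: "psi n lam x \<in> reverse_ssyt n lam" using psi_in_reverse[OF lam n x] .
  have wt_eq: "Sigma_wt n lam x k = (if k \<in> {1..n} then - total_height n lam k (psi n lam x) else 0)" for k
    using Sigma_wt_eq[OF lam n tri] total_height_eq_sigma_zero[OF lam n x] by simp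
  show "wt ?C (psi n lam x) = wt ?S x"
    unfolding Sigma_simps reverse_crystal_simps[OF lam]
    by (intro ext) (simp only: wt_eq tableau_wt_eq[OF lam])
  fix i assume i: "i \<in> {1..n}"
  have eps: "Sigma_eps n lam i x = top_height n lam i (psi n lam x)"
    using total_le_top[OF lam, of i "psi n lam x"]
    unfolding Sigma_eps_def sigma_max_eq[OF lam n x i]
      total_height_eq_sigma_zero[OF lam n x i, symmetric] by simp
  show "eps ?C i (psi n lam x) = eps ?S i x"
    by (simp add: Sigma_simps eps reverse_crystal_operators(1)[OF lam T i])
  show "phi ?C i (psi n lam x) = phi ?S i x"
    using i by (simp add: Sigma_simps eps wt_eq pairing_def reverse_crystal_operators(2)[OF lam T i])
  show "et ?S i x \<in> with_zero ?S" "ft ?S i x \<in> with_zero ?S"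
    "map_option (psi n lam) (et ?S i x) = et ?C i (psi n lam x)"
    "map_option (psi n lam) (ft ?S i x) = ft ?C i (psi n lam x)"
    using Sigma_e_commutes[OF lam n x i] Sigma_f_commutes[OF lam n x i]
    unfolding with_zero_def Sigma_simps by blast+
qed

end
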